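(* Let $\Bbbk$ be an algebraically closed field of characteristic $0$, and let $K_{r_1,\ldots,r_n}$ be the complete multipartite graph with $1 \le r_1 \le \cdots \le r_n$. If $n\le 4$, then the conic divisorial ideals of the edge ring $\Bbbk[K_{r_1,\ldots,r_n}]$ are in one-to-one correspondence with the points of $\mathcal{C}(r_1,\ldots,r_n)\cap\mathbb{Z}^n$.
   Context: $K_{r_1,\ldots,r_n}$ is the graph with vertex set $\bigsqcup_{i=1}^n V_i$, $|V_i|=r_i$, and edges all $\{a,b\}$ with $a\in V_i$, $b\in V_j$, $1\le i<j\le n$. For a graph $G$ on $\{1,\dots,d\}$, the edge ring $\Bbbk[G]$ is the subalgebra of $\Bbbk[t_1,\ldots,t_d]$ generated by $t_it_j$ for all edges $\{i,j\}$ of $G$. The edge ring of a complete multipartite graph is a normal affine monoid algebra. The polytope $\mathcal{C}(r_1,\ldots,r_n)$ is the set of $(z_1,\ldots,z_n)\in\mathbb{R}^n$ satisfying: (1) $-r_i \le z_j-z_i\le r_j$ for all $1\le i,j\le n$; (2) $-|J|-\sum_{i\in[n-1]\setminus I} r_i-\sum_{j\in J}r_j+1\le \sum_{i\in I}z_i-\sum_{j\in J}z_j\le |J|+1$ for all $I,J\subset[n-1]$ with $|I|=|J|+1$ and $I\cap J=\emptyset$; (3) $-|J|-\sum_{i\in[n-1]\setminus I} r_i-\sum_{j\in J}r_j+2\le \sum_{i\in I}z_i-\sum_{j\in J}z_j\le |J|$ for all $I\subset[n-1]$ and $J\subset[n]$ with $|I|=|J|+1$, $n\in J$ and $I\cap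 J=\emptyset$. Here $[k]=\{1,\ldots,k\}$; $I$ is an ordinary non-empty set, while $J$ is regarded as a multiset and may be empty (with $|J|$ and sums over $J$ counted with multiplicity). Conic divisorial ideals. Write a normal affine monoid algebra as $R=\Bbbk[C\cap\mathbb{Z}^e]$, where $\mathbb{Z}^e$ is identified with the group generated by the monoid and $C\subset\mathbb{R}^e$ is a full-dimensional finitely generated pointed cone whose facets are defined by $\langle\tau_i,\mathbf{x}\rangle\ge 0$ for $i=1,\ldots,m$, with $\tau_i$ primitive integral linear forms. Put $\tau(\mathbf{x})=(\langle\tau_1,\mathbf{x}\rangle,\ldots,\langle\tau_m,\mathbf{x}\rangle)$. For $\mathbf{a}\in\mathbb{Z}^m$, the divisorial ideal $T(\mathbf{a})$ is the $R$-module generated by the Laurent monomials whose exponents lie in $\{\mathbf{x}\in\mathbb{Z}^e:\tau(\mathbf{x})\ge\mathbf{a}\}$ (componentwise inequality); $T(\mathbf{a})\cong T(\mathbf{a}')$ if and only if $\mathbf{a}-\mathbf{a}'\in\tau(\mathbb{Z}^e)$. The divisorial ideal $T(\mathbf{a})$ is called conic if $\mathbf{a}=\lceil\tau(\mathbf{x})\rceil$ (componentwise ceiling) for some $\mathbf{x}\in\mathbb{R}^e$. Conic divisorial ideals are considered up to isomorphism.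
   Formalization: The formal theorem assumes n = 4, or n = 3 with r_1 ≥ 2; in all other cases with n ≤ 4 (n = 1, n = 2, and n = 3 with r_1 = 1) the claimed correspondence fails, e.g. K_{1,1} has 1 conic class but 3 integer points. *)

theory Defs
  imports "HOL-Analysis.Analysis" "HOL-Library.Poly_Mapping" "HOL-Library.Multiset"
    "HOL-Computational_Algebra.Polynomial"
begin

subsection \<open>Edge rings\<close>

text \<open>
  Laurent polynomials over \<open>'k\<close> in variables indexed by a finite vertex type \<open>'v\<close>; the
  multiplication of \<open>\<Rightarrow>\<^sub>0\<close> is convolution. The ordinary polynomial ring is the subring of elements
  supported on non-negative exponents, so a subalgebra of it is a subalgebra of this ring.
\<close>

type_synonym ('v, 'k) laurent = "(int ^ 'v) \<Rightarrow>\<^sub>0 'k"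

definition lmonom :: "int ^ 'v \<Rightarrow> ('v::finite, 'k::field) laurent" where
  "lmonom u = Poly_Mapping.single u 1"

definition var :: "'v \<Rightarrow> ('v::finite, 'k::field) laurent" where
  "var v = lmonom (axis v 1)"

definition subalgebra :: "('v::finite, 'k::field) laurent set \<Rightarrow> bool" where
  "subalgebra A \<longleftrightarrow> (\<forall>c. Poly_Mapping.single 0 c \<in> A) \<and>
     (\<forall>f\<in>A. \<forall>g\<in>A. f + g \<in> A) \<and> (\<forall>f\<in>A. \<forall>g\<in>A. f * g \<in> A)"

definition edge_ring :: "'v set set \<Rightarrow> ('v::finite, 'k::field) laurent set" where
  "edge_ring E = subalgebra hull {var i * var j | i j. {i, j} \<in> E}"

definition multipartite_edges :: "nat \<Rightarrow> (nat \<Rightarrow> 'v set) \<Rightarrow> 'v set set" where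
  "multipartite_edges n V = {{a, b} | a b i j. a \<in> V i \<and> b \<in> V j \<and> 1 \<le> i \<and> i < j \<and> j \<le> n}"

subsection \<open>The lattice, cone and facets of a monoid algebra\<close>

text \<open>
  Everything below takes the monoid algebra \<open>R\<close> as a subring of the Laurent polynomial ring. Its
  monoid is recovered as the set of exponents of the monomials in \<open>R\<close>. The lattice
  \<open>\<int>\<^sup>e\<close> is the group \<open>exp_group R\<close>, and \<open>\<real>\<^sup>e\<close> is its real span, in which the cone is
  full-dimensional.
\<close>

definition exp_monoid :: "('v::finite, 'k::field) laurent set \<Rightarrow> (int ^ 'v) set" where
  "exp_monoid R = {u. lmonom u \<in> R}"

definition exp_group :: "('v::finite, 'k::field) laurent set \<Rightarrow> (int ^ 'v) set" where
  "exp_group R = {u - v | u v. u \<in> exp_monoid R \<and> v \<in> exp_monoid R}"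

definition real_vec :: "int ^ 'v \<Rightarrow> real ^ 'v::finite" where
  "real_vec u = (\<chi> i. real_of_int (u $ i))"

definition exp_cone :: "('v::finite, 'k::field) laurent set \<Rightarrow> (real ^ 'v) set" where
  "exp_cone R = conic hull (convex hull (real_vec ` exp_monoid R))"

definition exp_space :: "('v::finite, 'k::field) laurent set \<Rightarrow> (real ^ 'v) set" where
  "exp_space R = span (real_vec ` exp_group R)"

text \<open>
  The linear forms \<open>\<tau>\<^sub>1, \<dots>, \<tau>\<^sub>m\<close>. A linear form on \<open>exp_space R\<close> is represented by the unique
  vector of \<open>exp_space R\<close> giving it through the inner product. It is integral and primitive iff it
  maps the lattice onto \<open>\<int>\<close>, so each facet has exactly one such form.
\<close>

definition facet_forms :: "('v::finite, 'k::field) laurent set \<Rightarrow> (real ^ 'v) set" where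
  "facet_forms R = {w \<in> exp_space R.
     (\<forall>x\<in>exp_cone R. 0 \<le> w \<bullet> x) \<and>
     {x \<in> exp_cone R. w \<bullet> x = 0} facet_of exp_cone R \<and>
     (\<lambda>u. w \<bullet> real_vec u) ` exp_group R = \<int>}"

subsection \<open>Conic divisorial ideals\<close>

definition submodule_of ::
    "('v::finite, 'k::field) laurent set \<Rightarrow> ('v, 'k) laurent set \<Rightarrow> bool" where
  "submodule_of R N \<longleftrightarrow> 0 \<in> N \<and> (\<forall>f\<in>N. \<forall>g\<in>N. f + g \<in> N) \<and> (\<forall>s\<in>R. \<forall>f\<in>N. s * f \<in> N)"

text \<open>
  An element of \<open>\<int>\<^sup>m\<close> is a function on the facet forms; its values elsewhere are irrelevant.
\<close>

definition divisorial_ideal ::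
    "('v::finite, 'k::field) laurent set \<Rightarrow> (real ^ 'v \<Rightarrow> int) \<Rightarrow> ('v, 'k) laurent set" where
  "divisorial_ideal R a = submodule_of R hull
     (lmonom ` {u \<in> exp_group R. \<forall>w\<in>facet_forms R. real_of_int (a w) \<le> w \<bullet> real_vec u})"

definition conic_divisorial_ideals ::
    "('v::finite, 'k::field) laurent set \<Rightarrow> ('v, 'k) laurent set set" where
  "conic_divisorial_ideals R =
     {divisorial_ideal R a | a. \<exists>x\<in>exp_space R. \<forall>w\<in>facet_forms R. a w = \<lceil>w \<bullet> x\<rceil>}"

definition module_iso ::
    "('v::finite, 'k::field) laurent set \<Rightarrow> ('v, 'k) laurent set \<Rightarrow> ('v, 'k) laurent set \<Rightarrow> bool" where
  "module_iso R M N \<longleftrightarrow> (\<exists>\<phi>. bij_betw \<phi> M N \<and>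
     (\<forall>f\<in>M. \<forall>g\<in>M. \<phi> (f + g) = \<phi> f + \<phi> g) \<and> (\<forall>s\<in>R. \<forall>f\<in>M. \<phi> (s * f) = s * \<phi> f))"

definition conic_classes ::
    "('v::finite, 'k::field) laurent set \<Rightarrow> ('v, 'k) laurent set set set" where
  "conic_classes R = conic_divisorial_ideals R //
     {(M, N). M \<in> conic_divisorial_ideals R \<and> N \<in> conic_divisorial_ideals R \<and> module_iso R M N}"

subsection \<open>The polytope\<close>

text \<open>
  Points of \<open>\<real>\<^sup>n\<close> are extensional functions on \<open>{1..n}\<close>, so that distinct functions are distinct
  points. The set \<open>I\<close> is non-empty because its cardinality is \<open>size J + 1\<close>.
\<close>

definition multipartite_polytope :: "nat \<Rightarrow> (nat \<Rightarrow> nat) \<Rightarrow> (nat \<Rightarrow> real) set" where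
  "multipartite_polytope n r = {z \<in> extensional {1..n}.
     (\<forall>i\<in>{1..n}. \<forall>j\<in>{1..n}. - real (r i) \<le> z j - z i \<and> z j - z i \<le> real (r j)) \<and>
     (\<forall>I J. I \<subseteq> {1..n-1} \<and> set_mset J \<subseteq> {1..n-1} \<and>
            card I = size J + 1 \<and> I \<inter> set_mset J = {} \<longrightarrow>
        - real (size J) - (\<Sum>i\<in>{1..n-1} - I. real (r i)) - (\<Sum>j\<in>#J. real (r j)) + 1
          \<le> (\<Sum>i\<in>I. z i) - (\<Sum>j\<in>#J. z j) \<and>
        (\<Sum>i\<in>I. z i) - (\<Sum>j\<in>#J. z j) \<le> real (size J) + 1) \<and>
     (\<forall>I J. I \<subseteq> {1..n-1} \<and> set_mset J \<subseteq> {1..n} \<and>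
            card I = size J + 1 \<and> n \<in># J \<and> I \<inter> set_mset J = {} \<longrightarrow>
        - real (size J) - (\<Sum>i\<in>{1..n-1} - I. real (r i)) - (\<Sum>j\<in>#J. real (r j)) + 2
          \<le> (\<Sum>i\<in>I. z i) - (\<Sum>j\<in>#J. z j) \<and>
        (\<Sum>i\<in>I. z i) - (\<Sum>j\<in>#J. z j) \<le> real (size J))}"

definition integer_points :: "nat \<Rightarrow> (nat \<Rightarrow> real) set" where
  "integer_points n = {1..n} \<rightarrow>\<^sub>E \<int>"

end

theory Submission
  imports Defs
begin

text \<open>
  The facets of the cone are \<open>x\<^sub>v \<ge> 0\<close> for the vertices \<open>v\<close>, and
  \<open>\<sigma>\<^sub>i(x) = (S - 2 S\<^sub>i) / 2 \<ge> 0\<close> for the parts \<open>i\<close>, where \<open>S\<close> is the sum of all coordinates and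
  \<open>S\<^sub>i\<close> the sum over part \<open>i\<close>; the lattice consists of the integer vectors with even \<open>S\<close>.
  Modulo the lattice, an integer vector \<open>a\<close> on the facets is determined by the numbers
  \<open>z\<^sub>i = y\<^sub>i + y\<^sub>n\<close>, where \<open>y\<^sub>i = a(\<sigma>\<^sub>i) - A / 2 + A\<^sub>i\<close> and \<open>A\<close>, \<open>A\<^sub>i\<close> are the sums of the values of
  \<open>a\<close> at the vertices. For \<open>a = \<lceil>\<tau>(x)\<rceil>\<close> one gets \<open>y\<^sub>i = g\<^sub>i + F\<^sub>i - F / 2\<close>, where
  \<open>0 \<le> g\<^sub>i < 1\<close> and \<open>0 \<le> F\<^sub>i < r\<^sub>i\<close> collect the rounding errors and \<open>F = \<Sum>F\<^sub>i\<close>, and all such \<open>F\<close>, \<open>g\<close>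
  making \<open>z\<close> integral occur. The inequalities of the polytope follow by rounding. Conversely, with
  \<open>s = F / 2\<close> one needs \<open>max 0 (y\<^sub>i + s - 1) < F\<^sub>i < min r\<^sub>i (y\<^sub>i + s)\<close> and \<open>\<Sum>F\<^sub>i = 2 s\<close>, which are linear
  bounds on the single number \<open>s\<close>; for \<open>n \<le> 4\<close> each lower bound lies below each upper bound by the
  inequalities of the polytope.
\<close>

subsection \<open>Laurent polynomials\<close>

text \<open>An element is the sum of its finitely many terms, so ideals, subalgebras and solution
  sets of additive identities can be tested on single terms.\<close>

lemma poly_mapping_in_closed:
  fixes f :: "'a \<Rightarrow>\<^sub>0 'b::comm_monoid_add"
  assumes "0 \<in> A" and add: "\<And>f g. f \<in> A \<Longrightarrow> g \<in> A \<Longrightarrow> f + g \<in> A"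
    and single: "\<And>u. u \<in> Poly_Mapping.keys f \<Longrightarrow>
      Poly_Mapping.single u (Poly_Mapping.lookup f u) \<in> A"
  shows "f \<in> A"
proof -
  have "(\<Sum>u\<in>K. Poly_Mapping.single u (Poly_Mapping.lookup f u)) \<in> A"
    if "finite K" "K \<subseteq> Poly_Mapping.keys f" for K
    using that by (induction K) (simp_all add: assms)
  moreover have "f = (\<Sum>u\<in>Poly_Mapping.keys f. Poly_Mapping.single u (Poly_Mapping.lookup f u))"
    by (rule poly_mapping_eqI)
      (simp add: lookup_sum lookup_single when_def in_keys_iff sum.delta')
  ultimately show ?thesis
    by (metis finite_keys order_refl)
qed

lemma lookup_mult_group:
  fixes f g :: "'a::ab_group_add \<Rightarrow>\<^sub>0 'b::semiring_0"
  shows "Poly_Mapping.lookup (f * g) k =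
    (\<Sum>l\<in>Poly_Mapping.keys f. Poly_Mapping.lookup f l * Poly_Mapping.lookup g (k - l))"
proof -
  have "(k = l + q) = (q = k - l)" for l q :: 'a
    by (auto simp: algebra_simps)
  then have "Poly_Mapping.lookup (f * g) k =
      (\<Sum>l. Poly_Mapping.lookup f l * Poly_Mapping.lookup g (k - l))"
    by (simp add: lookup_mult)
  also have "\<dots> = (\<Sum>l\<in>Poly_Mapping.keys f. Poly_Mapping.lookup f l * Poly_Mapping.lookup g (k - l))"
    by (rule Sum_any.expand_superset) (auto simp: in_keys_iff)
  finally show ?thesis .
qed

text \<open>A vector on which two points agree lies in the hyperplane orthogonal to their
  difference. Finitely many hyperplanes are negligible, so a generic \<open>w\<close> separates all
  the points; it will serve as a term order on exponents.\<close>

lemma ex_inj_on_inner: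
  fixes S :: "'a::euclidean_space set"
  assumes "finite S"
  obtains w where "inj_on (\<lambda>x. w \<bullet> x) S"
proof -
  let ?P = "{p \<in> S \<times> S. fst p \<noteq> snd p}"
  have "finite ?P"
    using assms by auto
  then have "negligible (\<Union>p\<in>?P. {w. (fst p - snd p) \<bullet> w = 0})"
    by (intro negligible_Union finite_imageI) (auto intro!: negligible_hyperplane)
  then have "(\<Union>p\<in>?P. {w. (fst p - snd p) \<bullet> w = 0}) \<noteq> UNIV"
    using non_negligible_UNIV by metis
  then obtain w where "\<forall>x\<in>S. \<forall>y\<in>S. x \<noteq> y \<longrightarrow> (x - y) \<bullet> w \<noteq> 0"
    by fastforce
  then have "inj_on (\<lambda>x. w \<bullet> x) S"
    by (auto simp: inj_on_def inner_diff_left inner_commute[of w])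
  then show ?thesis ..
qed

lemma real_vec_zero [simp]: "real_vec 0 = 0"
  by (simp add: real_vec_def vec_eq_iff)

lemma real_vec_add: "real_vec (u + v) = real_vec u + real_vec v"
  by (simp add: real_vec_def vec_eq_iff)

lemma real_vec_diff: "real_vec (u - v) = real_vec u - real_vec v"
  by (simp add: real_vec_def vec_eq_iff)

lemma real_vec_scale: "real_vec (c *s u) = of_int c *\<^sub>R real_vec u"
  by (simp add: real_vec_def vec_eq_iff)

lemma inj_real_vec: "inj real_vec"
  by (auto simp: inj_def real_vec_def vec_eq_iff)

text \<open>A generic linear functional orders the exponents of both factors. The product of the two
  leading terms cannot cancel, nor can that of the two lowest terms; both must be the constant term
  of 1, so the highest and the lowest exponent of \<open>f\<close> coincide.\<close>

lemma laurent_unit: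
  fixes f g :: "('v::finite, 'k::field) laurent"
  assumes "f * g = 1"
  obtains u c where "f = Poly_Mapping.single u c" "c \<noteq> 0"
proof -
  let ?F = "Poly_Mapping.keys f" and ?G = "Poly_Mapping.keys g"
  have ne: "?F \<noteq> {}" "?G \<noteq> {}"
    using assms by (metis keys_eq_empty mult_zero_left mult_zero_right zero_neq_one)+
  obtain w where w: "inj_on (\<lambda>x. w \<bullet> x) (real_vec ` (?F \<union> ?G))"
    using ex_inj_on_inner[of "real_vec ` (?F \<union> ?G)"] by auto
  define l where "l = (\<lambda>u. w \<bullet> real_vec u)"
  have inj: "inj_on l (?F \<union> ?G)"
    using comp_inj_on[OF inj_on_subset[OF inj_real_vec] w] by (simp add: l_def o_def)
  \<comment> \<open>\<open>m\<close> will be \<open>l\<close> for the leading terms and its negative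
    for the lowest ones. At \<open>u + v\<close> only the summand \<open>x = u\<close> of the
    convolution survives: any other \<open>x\<close> would need a partner above the maximum of
    \<open>m\<close> on the exponents of \<open>g\<close>.\<close>
  have extremal: "u + v = 0"
    if u: "u \<in> ?F" "\<And>x. x \<in> ?F \<Longrightarrow> m x \<le> m u" and v: "v \<in> ?G" "\<And>x. x \<in> ?G \<Longrightarrow> m x \<le> m v"
      and m: "inj_on m (?F \<union> ?G)" "\<And>x y. m (x + y) = m x + m y" for u v and m :: "_ \<Rightarrow> real"
  proof -
    have "u + v - x \<notin> ?G" if "x \<in> ?F" "x \<noteq> u" for x
    proof
      assume "u + v - x \<in> ?G"
      then have "m (u + v - x) \<le> m v"
        by (rule v)
      moreover have "m x < m u"
        using that u(2)[of x] inj_onD[OF m(1), of x u] u(1) by (auto simp: less_le)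
      moreover have "m (u + v - x) + m x = m u + m v"
        by (metis m(2) diff_add_cancel)
      ultimately show False
        by linarith
    qed
    then have "Poly_Mapping.lookup (f * g) (u + v) =
        (\<Sum>x\<in>?F. if x = u then Poly_Mapping.lookup f u * Poly_Mapping.lookup g v else 0)"
      unfolding lookup_mult_group by (intro sum.cong) (auto simp: in_keys_iff)
    also have "\<dots> \<noteq> 0"
      using u(1) v(1) by (simp add: in_keys_iff)
    finally show ?thesis
      by (simp add: assms lookup_one)
  qed
  have add: "l (x + y) = l x + l y" for x y
    by (simp add: l_def real_vec_add inner_add_right)
  have max: "\<exists>u\<in>K. \<forall>x\<in>K. m x \<le> m u" if "finite K" "K \<noteq> {}" for K and m :: "int ^ 'v \<Rightarrow> real"
  proof -
    have "Max (m ` K) \<in> m ` K"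
      using that by (intro Max_in) auto
    then obtain u where "u \<in> K" "Max (m ` K) = m u"
      by blast
    then show ?thesis
      using that Max_ge[of "m ` K"] by (intro bexI[of _ u]) auto
  qed
  obtain u v where u: "u \<in> ?F" "\<And>x. x \<in> ?F \<Longrightarrow> l x \<le> l u"
    and v: "v \<in> ?G" "\<And>x. x \<in> ?G \<Longrightarrow> l x \<le> l v"
    using max[of ?F l] max[of ?G l] ne by auto
  obtain u' v' where u': "u' \<in> ?F" "\<And>x. x \<in> ?F \<Longrightarrow> l u' \<le> l x"
    and v': "v' \<in> ?G" "\<And>x. x \<in> ?G \<Longrightarrow> l v' \<le> l x"
    using max[of ?F "\<lambda>x. - l x"] max[of ?G "\<lambda>x. - l x"] ne by auto
  have "u + v = 0"
    using extremal[of u l v] u v inj add by simp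
  moreover have "u' + v' = 0"
    using extremal[of u' "\<lambda>x. - l x" v'] u' v' inj add by (simp add: inj_on_def)
  ultimately have "l u + l v = l u' + l v'"
    by (metis add)
  then have eq: "l u = l u'"
    using u(2)[OF u'(1)] v(2)[OF v'(1)] by linarith
  have "x = u" if "x \<in> ?F" for x
    using u(2)[OF that] u'(2)[OF that] inj_onD[OF inj, of x u] that u(1) eq by auto
  then have "?F = {u}"
    using u(1) by blast
  then have zero: "Poly_Mapping.lookup f k = 0" if "k \<noteq> u" for k
    using that by (simp flip: not_in_keys_iff_lookup_eq_zero)
  have "f = Poly_Mapping.single u (Poly_Mapping.lookup f u)"
    by (rule poly_mapping_eqI) (simp add: lookup_single when_def zero)
  then show ?thesis
    by (rule that) (use u(1) in \<open>simp add: in_keys_iff\<close>)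
qed

subsection \<open>Monoid algebras of full-dimensional cones\<close>

text \<open>\<open>L\<close> is a lattice of full rank and \<open>T\<close> will turn out to be the
  set of primitive facet forms. \<open>facet_point\<close> puts a lattice point into the relative
  interior of each facet and so excludes redundant forms; \<open>interior_point\<close> makes the
  cone full-dimensional; \<open>exp_cone_eq\<close> says that the monoid generates the real cone cut
  out by the forms.\<close>

locale normal_monoid_ring =
  fixes R :: "('v::finite, 'k::field) laurent set"
    and L :: "(int ^ 'v) set" and T :: "(real ^ 'v) set"
  assumes R_eq: "R = {f. Poly_Mapping.keys f \<subseteq> {u \<in> L. \<forall>w\<in>T. 0 \<le> w \<bullet> real_vec u}}"
    and zero_L: "0 \<in> L" and diff_L: "\<And>u v. u \<in> L \<Longrightarrow> v \<in> L \<Longrightarrow> u - v \<in> L"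
    and finite_T: "finite T"
    and integral: "\<And>w u. w \<in> T \<Longrightarrow> u \<in> L \<Longrightarrow> w \<bullet> real_vec u \<in> \<int>"
    and primitive: "\<And>w. w \<in> T \<Longrightarrow> \<exists>u\<in>L. w \<bullet> real_vec u = 1"
    and facet_point:
      "\<And>w. w \<in> T \<Longrightarrow> \<exists>u\<in>L. w \<bullet> real_vec u = 0 \<and> (\<forall>w'\<in>T - {w}. 1 \<le> w' \<bullet> real_vec u)"
    and interior_point: "\<exists>u\<in>L. \<forall>w\<in>T. 1 \<le> w \<bullet> real_vec u"
    and exp_cone_eq: "exp_cone R = {x. \<forall>w\<in>T. 0 \<le> w \<bullet> x}"
    and span_L: "span (real_vec ` L) = UNIV"
begin

lemma uminus_L: "u \<in> L \<Longrightarrow> - u \<in> L"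
  using diff_L[OF zero_L] by simp

lemma add_L: "u \<in> L \<Longrightarrow> v \<in> L \<Longrightarrow> u + v \<in> L"
  using diff_L[OF _ uminus_L] by simp

lemma scale_L:
  assumes "u \<in> L"
  shows "c *s u \<in> L"
proof -
  have nat: "int n *s u \<in> L" for n
    by (induction n) (simp_all add: zero_L add_L assms vector_sadd_rdistrib)
  have "c *s u = int (nat c) *s u \<or> c *s u = - (int (nat (- c)) *s u)"
    by (cases "0 \<le> c") (auto simp: vec_eq_iff)
  with nat uminus_L show ?thesis
    by metis
qed

lemma exp_monoid_eq: "exp_monoid R = {u \<in> L. \<forall>w\<in>T. 0 \<le> w \<bullet> real_vec u}"
  by (auto simp: exp_monoid_def R_eq lmonom_def)

lemma single_in_R: "u \<in> L \<Longrightarrow> (\<And>w. w \<in> T \<Longrightarrow> 0 \<le> w \<bullet> real_vec u) \<Longrightarrow> Poly_Mapping.single u c \<in> R"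
  by (simp add: R_eq)

text \<open>Bounding every \<open>b w\<close> by the sum of all absolute values gives one multiple
  for all forms at once. With \<open>T' = T\<close> it leads deep into the cone, with
  \<open>T' = T - {w}\<close> far along the facet of \<open>w\<close>.\<close>

lemma interior_multiple:
  assumes "\<And>w. w \<in> T' \<Longrightarrow> w \<in> T" "\<And>w. w \<in> T' \<Longrightarrow> 1 \<le> w \<bullet> real_vec q"
  obtains n :: nat where "\<And>w. w \<in> T' \<Longrightarrow> b w \<le> w \<bullet> real_vec (int n *s q)"
proof -
  obtain n where n: "(\<Sum>w\<in>T. \<bar>b w\<bar>) \<le> real n"
    using real_arch_simple by blast
  have "b w \<le> w \<bullet> real_vec (int n *s q)" if "w \<in> T'" for w
  proof -
    have "b w \<le> \<bar>b w\<bar>"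
      by simp
    also have "\<dots> \<le> (\<Sum>w\<in>T. \<bar>b w\<bar>)"
      using assms(1)[OF that] finite_T by (intro member_le_sum) auto
    also have "\<dots> \<le> real n * 1"
      using n by simp
    also have "\<dots> \<le> real n * (w \<bullet> real_vec q)"
      using assms(2)[OF that] by (intro mult_left_mono) auto
    finally show ?thesis
      by (simp add: real_vec_scale)
  qed
  then show ?thesis
    using that by blast
qed

text \<open>Adding a large multiple of an interior lattice point moves any lattice point into the
  cone, so it is a difference of two elements of the monoid.\<close>

lemma exp_group_eq: "exp_group R = L"
proof
  show "exp_group R \<subseteq> L"
    by (auto simp: exp_group_def exp_monoid_eq diff_L)
  show "L \<subseteq> exp_group R"
  proof
    fix u assume u: "u \<in> L"
    obtain q where q: "q \<in> L" "\<And>w. w \<in> T \<Longrightarrow> 1 \<le> w \<bullet> real_vec q"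
      using interior_point by blast
    obtain n where n: "\<And>w. w \<in> T \<Longrightarrow> \<bar>w \<bullet> real_vec u\<bar> \<le> w \<bullet> real_vec (int n *s q)"
      using interior_multiple[of T q "\<lambda>w. \<bar>w \<bullet> real_vec u\<bar>"] q by metis
    have "int n *s q \<in> exp_monoid R" "u + int n *s q \<in> exp_monoid R"
      using n u q by (force simp: exp_monoid_eq scale_L add_L real_vec_add inner_add_right)+
    moreover have "u = (u + int n *s q) - int n *s q"
      by simp
    ultimately show "u \<in> exp_group R"
      unfolding exp_group_def by blast
  qed
qed

lemma exp_space_eq: "exp_space R = UNIV"
  by (simp add: exp_space_def exp_group_eq span_L)

section \<open>Facets of the cone\<close>

lemma nonzero_T: "w \<in> T \<Longrightarrow> w \<noteq> 0"
  using primitive by force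

text \<open>Near \<open>y\<close> the inequalities of \<open>T'\<close> hold strictly, and the one
  remaining form vanishes on \<open>H\<close>; a convex set keeps its dimension when met with an
  open set that it touches. \<open>H = UNIV\<close> gives the dimension of the cone, and a
  hyperplane \<open>H\<close> that of a facet.\<close>

lemma aff_dim_cone_Int_hyperplane:
  assumes "T' \<subseteq> T" "T - T' \<subseteq> {w}" "\<And>x. x \<in> H \<Longrightarrow> w \<in> T - T' \<Longrightarrow> w \<bullet> x = 0"
    and "convex H" "y \<in> H" "\<And>w. w \<in> T' \<Longrightarrow> 0 < w \<bullet> y"
  shows "aff_dim ({x. \<forall>w\<in>T. 0 \<le> w \<bullet> x} \<inter> H) = aff_dim H"
proof (rule antisym)
  show "aff_dim ({x. \<forall>w\<in>T. 0 \<le> w \<bullet> x} \<inter> H) \<le> aff_dim H"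
    by (intro aff_dim_subset) auto
  let ?U = "\<Inter>w\<in>T'. {x. w \<bullet> x > 0}"
  have "finite T'"
    using finite_T assms(1) by (rule rev_finite_subset)
  then have "open ?U"
    by (auto intro!: open_INT open_halfspace_gt)
  then have "aff_dim H = aff_dim (H \<inter> ?U)"
    using assms(4-6) by (intro aff_dim_convex_Int_open[symmetric]) auto
  also have "\<dots> \<le> aff_dim ({x. \<forall>w\<in>T. 0 \<le> w \<bullet> x} \<inter> H)"
  proof (intro aff_dim_subset subsetI IntI CollectI ballI)
    fix x t assume "x \<in> H \<inter> ?U" "t \<in> T"
    then show "0 \<le> t \<bullet> x"
      using assms(2,3) by (cases "t \<in> T'") (auto simp: less_imp_le)
  qed auto
  finally show "aff_dim H \<le> aff_dim ({x. \<forall>w\<in>T. 0 \<le> w \<bullet> x} \<inter> H)" .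
qed

lemma convex_cone: "convex {x. \<forall>w\<in>T. 0 \<le> w \<bullet> x}"
  by (auto simp: convex_def inner_add_right)

lemma aff_dim_cone: "aff_dim {x. \<forall>w\<in>T. 0 \<le> w \<bullet> x} = DIM(real ^ 'v)"
proof -
  obtain q where "\<And>w. w \<in> T \<Longrightarrow> 1 \<le> w \<bullet> real_vec q"
    using interior_point by blast
  then have "aff_dim ({x. \<forall>w\<in>T. 0 \<le> w \<bullet> x} \<inter> UNIV) = aff_dim (UNIV :: (real ^ 'v) set)"
    by (intro aff_dim_cone_Int_hyperplane[where T' = T and y = "real_vec q"]) force+
  then show ?thesis
    by simp
qed

text \<open>For the harder inclusion, some \<open>t\<close> in \<open>T\<close> vanishes on the
  whole facet of \<open>w\<close>. The facet spans a hyperplane, so \<open>w\<close> is a multiple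
  of \<open>t\<close>, and primitivity of both together with nonnegativity on the cone makes the
  factor 1.\<close>

lemma facet_forms_eq: "facet_forms R = T"
proof (intro equalityI subsetI)
  fix w assume w: "w \<in> T"
  let ?F = "{x. \<forall>w\<in>T. 0 \<le> w \<bullet> x} \<inter> {x. w \<bullet> x = 0}"
  obtain q where q: "w \<bullet> real_vec q = 0" "\<And>w'. w' \<in> T - {w} \<Longrightarrow> 1 \<le> w' \<bullet> real_vec q"
    using facet_point[OF w] by blast
  have "aff_dim ?F = aff_dim {x. w \<bullet> x = 0}"
    by (rule aff_dim_cone_Int_hyperplane[where T' = "T - {w}" and w = w and y = "real_vec q"])
      (use q w in \<open>auto simp: convex_hyperplane intro: less_le_trans[of 0 1]\<close>)
  then have "aff_dim ?F = int DIM(real ^ 'v) - 1"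
    using nonzero_T[OF w] by (simp add: aff_dim_hyperplane of_nat_diff Suc_leI)
  moreover have "?F face_of {x. \<forall>w\<in>T. 0 \<le> w \<bullet> x}"
    using w by (intro face_of_Int_supporting_hyperplane_ge convex_cone) auto
  moreover have "0 \<in> ?F"
    by simp
  ultimately have "?F facet_of {x. \<forall>w\<in>T. 0 \<le> w \<bullet> x}"
    unfolding facet_of_def aff_dim_cone by blast
  moreover have "(\<lambda>u. w \<bullet> real_vec u) ` L = \<int>"
  proof
    show "(\<lambda>u. w \<bullet> real_vec u) ` L \<subseteq> \<int>"
      using integral[OF w] by auto
    obtain u where u: "u \<in> L" "w \<bullet> real_vec u = 1"
      using primitive[OF w] by blast
    show "\<int> \<subseteq> (\<lambda>u. w \<bullet> real_vec u) ` L"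
    proof
      fix c :: real assume "c \<in> \<int>"
      then obtain k where "c = of_int k"
        by (auto elim: Ints_cases)
      then show "c \<in> (\<lambda>u. w \<bullet> real_vec u) ` L"
        using u by (intro image_eqI[where x = "k *s u"]) (auto simp: real_vec_scale scale_L)
    qed
  qed
  ultimately show "w \<in> facet_forms R"
    using w by (simp add: facet_forms_def exp_space_eq exp_cone_eq exp_group_eq Int_def)
next
  fix w assume "w \<in> facet_forms R"
  then have nonneg: "\<And>x. \<forall>w\<in>T. 0 \<le> w \<bullet> x \<Longrightarrow> 0 \<le> w \<bullet> x"
    and facet: "{x. (\<forall>w\<in>T. 0 \<le> w \<bullet> x) \<and> w \<bullet> x = 0} facet_of {x. \<forall>w\<in>T. 0 \<le> w \<bullet> x}"
    and prim: "(\<lambda>u. w \<bullet> real_vec u) ` L = \<int>"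
    unfolding facet_forms_def exp_cone_eq exp_group_eq mem_Collect_eq by blast+
  define F where "F = {x. (\<forall>w\<in>T. 0 \<le> w \<bullet> x) \<and> w \<bullet> x = 0}"
  have "1 \<in> (\<lambda>u. w \<bullet> real_vec u) ` L"
    by (simp add: prim)
  then obtain p where p: "p \<in> L" "w \<bullet> real_vec p = 1"
    by auto
  have w0: "w \<noteq> 0"
    using p by auto
  have "\<exists>t\<in>T. \<forall>x\<in>F. t \<bullet> x = 0"
  proof (rule ccontr)
    assume "\<not> (\<exists>t\<in>T. \<forall>x\<in>F. t \<bullet> x = 0)"
    then have "\<forall>t\<in>T. \<exists>x. x \<in> F \<and> t \<bullet> x \<noteq> 0"
      by blast
    from bchoice[OF this] obtain x
      where x: "\<And>t. t \<in> T \<Longrightarrow> x t \<in> F" "\<And>t. t \<in> T \<Longrightarrow> t \<bullet> x t \<noteq> 0"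
      by blast
    \<comment> \<open>Every form is nonnegative at all the chosen points and positive at its own, so
      \<open>s\<close> is interior to the cone although \<open>w\<close> vanishes there. A small
      step from \<open>s\<close> against \<open>w\<close> stays in the cone and makes
      \<open>w\<close> negative.\<close>
    define s where "s = (\<Sum>t\<in>T. x t)"
    have ws: "w \<bullet> s = 0"
      using x by (simp add: F_def s_def inner_sum_right)
    have "0 < t \<bullet> s" if "t \<in> T" for t
    proof -
      have "t \<bullet> x t \<le> (\<Sum>t'\<in>T. t \<bullet> x t')"
        using x that finite_T by (intro member_le_sum) (auto simp: F_def)
      moreover have "0 < t \<bullet> x t"
        using x[OF that] that by (simp add: F_def less_le)
      ultimately show ?thesis
        by (simp add: s_def inner_sum_right)
    qed
    then have "s \<in> (\<Inter>t\<in>T. {x. t \<bullet> x > 0})"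
      by auto
    moreover have "open (\<Inter>t\<in>T. {x. t \<bullet> x > 0})"
      using finite_T by (auto intro!: open_INT open_halfspace_gt)
    ultimately obtain e where e: "e > 0" "cball s e \<subseteq> (\<Inter>t\<in>T. {x. t \<bullet> x > 0})"
      using open_contains_cball by metis
    define y where "y = s - (e / norm w) *\<^sub>R w"
    have "y \<in> cball s e"
      using e w0 by (simp add: y_def dist_norm)
    with e have "y \<in> (\<Inter>t\<in>T. {x. t \<bullet> x > 0})"
      by blast
    then have "0 \<le> w \<bullet> y"
      by (intro nonneg) (auto intro: less_imp_le)
    moreover have "w \<bullet> y = - (e / norm w) * (w \<bullet> w)"
      by (simp add: y_def inner_diff_right ws)
    moreover have "0 < (e / norm w) * (w \<bullet> w)"
      using e w0 by simp
    ultimately show False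
      by linarith
  qed
  then obtain t where t: "t \<in> T" "\<And>x. x \<in> F \<Longrightarrow> t \<bullet> x = 0"
    by blast
  have "0 \<in> affine hull F"
    by (intro hull_inc) (simp add: F_def)
  moreover have "aff_dim F = int DIM(real ^ 'v) - 1"
    using facet unfolding facet_of_def aff_dim_cone F_def by blast
  ultimately have "int (dim F) = int DIM(real ^ 'v) - 1"
    by (metis aff_dim_zero)
  then have dim: "dim F = DIM(real ^ 'v) - 1"
    by linarith
  \<comment> \<open>The face contains 0 and has codimension one, so the orthogonal hyperplane of any
    nonzero vector orthogonal to it equals its span.\<close>
  have span_eq: "span F = {x. a \<bullet> x = 0}" if "a \<noteq> 0" "F \<subseteq> {x. a \<bullet> x = 0}" for a
  proof (rule subspace_dim_equal)
    show "span F \<subseteq> {x. a \<bullet> x = 0}"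
      using that(2) by (rule span_minimal) (rule subspace_hyperplane)
    show "dim {x. a \<bullet> x = 0} \<le> dim (span F)"
      using that(1) by (simp add: dim dim_hyperplane)
  qed (simp_all add: subspace_hyperplane)
  have "{x. w \<bullet> x = 0} = {x. t \<bullet> x = 0}"
    using span_eq[OF w0] span_eq[OF nonzero_T[OF t(1)]] t(2) by (auto simp: F_def)
  moreover define c where "c = (t \<bullet> w) / (t \<bullet> t)"
  \<comment> \<open>\<open>x\<close> is the component of \<open>w\<close> orthogonal to
    \<open>t\<close>; it lies in the common hyperplane, hence is orthogonal to \<open>w\<close> as
    well and to itself.\<close>
  define x where "x = w - c *\<^sub>R t"
  have tx: "t \<bullet> x = 0"
    using nonzero_T[OF t(1)] by (simp add: x_def c_def inner_diff_right)
  ultimately have "w \<bullet> x = 0"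
    by blast
  then have "x \<bullet> x = 0"
    using tx by (simp add: x_def inner_diff_left)
  then have wc: "w = c *\<^sub>R t"
    by (simp add: x_def)
  \<comment> \<open>\<open>c\<close> is an integer because \<open>w\<close> takes the value
    \<open>c\<close> where \<open>t\<close> takes 1. It divides 1 because \<open>w\<close> takes the
    value 1 at \<open>p\<close>, and the interior point \<open>q\<close> excludes -1.\<close>
  obtain u where u: "u \<in> L" "t \<bullet> real_vec u = 1"
    using primitive[OF t(1)] by blast
  have "w \<bullet> real_vec u \<in> (\<lambda>u. w \<bullet> real_vec u) ` L"
    using u by blast
  then have "c \<in> \<int>"
    unfolding prim using u by (simp add: wc)
  then obtain k where k: "c = of_int k"
    by (auto elim: Ints_cases)
  obtain l where l: "t \<bullet> real_vec p = of_int l"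
    using integral[OF t(1) p(1)] by (auto elim: Ints_cases)
  have "k * l = 1"
    using p(2) k l by (simp add: wc flip: of_int_mult)
  moreover obtain q where q: "\<And>w. w \<in> T \<Longrightarrow> 1 \<le> w \<bullet> real_vec q"
    using interior_point by blast
  then have "0 \<le> c * (t \<bullet> real_vec q)"
    using nonneg[of "real_vec q"] by (simp add: wc) (meson dual_order.trans zero_le_one)
  then have "0 \<le> k"
    using q[OF t(1)] k by (simp add: zero_le_mult_iff)
  ultimately have "k = 1"
    by (simp add: zmult_eq_1_iff)
  then show "w \<in> T"
    using t(1) wc k by simp
qed

section \<open>Divisorial ideals and their isomorphisms\<close>

definition exponents :: "(real ^ 'v \<Rightarrow> int) \<Rightarrow> (int ^ 'v) set" where
  "exponents a = {u \<in> L. \<forall>w\<in>T. real_of_int (a w) \<le> w \<bullet> real_vec u}"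

lemma keys_times_R:
  assumes "s \<in> R" "Poly_Mapping.keys f \<subseteq> exponents a"
  shows "Poly_Mapping.keys (s * f) \<subseteq> exponents a"
proof
  fix u assume "u \<in> Poly_Mapping.keys (s * f)"
  then obtain p v where "u = p + v" "p \<in> Poly_Mapping.keys s" "v \<in> Poly_Mapping.keys f"
    using keys_mult by blast
  then show "u \<in> exponents a"
    using assms by (force simp: R_eq exponents_def add_L real_vec_add inner_add_right)
qed

lemma divisorial_ideal_eq: "divisorial_ideal R a = {f. Poly_Mapping.keys f \<subseteq> exponents a}"
  unfolding divisorial_ideal_def facet_forms_eq exp_group_eq exponents_def[symmetric]
proof (rule hull_unique)
  show "lmonom ` exponents a \<subseteq> {f. Poly_Mapping.keys f \<subseteq> exponents a}"
    by (auto simp: lmonom_def)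
  show "submodule_of R {f. Poly_Mapping.keys f \<subseteq> exponents a}"
    unfolding submodule_of_def mem_Collect_eq
    by (intro conjI ballI impI keys_times_R subset_trans[OF Poly_Mapping.keys_add]) auto
  fix N assume N: "lmonom ` exponents a \<subseteq> N" "submodule_of R N"
  show "{f. Poly_Mapping.keys f \<subseteq> exponents a} \<subseteq> N"
  proof
    fix f :: "('v, 'k) laurent" assume f: "f \<in> {f. Poly_Mapping.keys f \<subseteq> exponents a}"
    show "f \<in> N"
    proof (rule poly_mapping_in_closed)
      fix u assume "u \<in> Poly_Mapping.keys f"
      then have "lmonom u \<in> N"
        using N f by blast
      then have "Poly_Mapping.single 0 c * lmonom u \<in> N" for c
        using N(2) by (simp add: submodule_of_def single_in_R zero_L)
      then show "Poly_Mapping.single u (Poly_Mapping.lookup f u) \<in> N"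
        by (simp add: lmonom_def mult_single)
    qed (use N(2) in \<open>auto simp: submodule_of_def\<close>)
  qed
qed

text \<open>A multiple of a lattice point with \<open>w\<close>-value 1 attains the bound at
  \<open>w\<close>; moving along the facet of \<open>w\<close> keeps that value and raises all the
  other forms. Hence the ideal determines \<open>a\<close> on \<open>T\<close>.\<close>

lemma exponents_attained:
  assumes "w \<in> T"
  obtains u where "u \<in> exponents a" "w \<bullet> real_vec u = a w"
proof -
  obtain p where p: "p \<in> L" "w \<bullet> real_vec p = 1"
    using primitive[OF assms] by blast
  obtain q where q: "q \<in> L" "w \<bullet> real_vec q = 0" "\<And>w'. w' \<in> T - {w} \<Longrightarrow> 1 \<le> w' \<bullet> real_vec q"
    using facet_point[OF assms] by blast
  obtain n where n: "\<And>w'. w' \<in> T - {w} \<Longrightarrow>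
      a w' - w' \<bullet> real_vec (a w *s p) \<le> w' \<bullet> real_vec (int n *s q)"
    using interior_multiple[of "T - {w}" q "\<lambda>w'. a w' - w' \<bullet> real_vec (a w *s p)"] q(3)
    by (metis Diff_iff)
  let ?u = "a w *s p + int n *s q"
  have "w \<bullet> real_vec ?u = a w"
    using p q by (simp add: real_vec_add real_vec_scale inner_add_right)
  moreover have "a w' \<le> w' \<bullet> real_vec ?u" if "w' \<in> T - {w}" for w'
    using n[OF that] by (simp add: real_vec_add inner_add_right algebra_simps)
  ultimately have "a w' \<le> w' \<bullet> real_vec ?u" if "w' \<in> T" for w'
    using that by (cases "w' = w") auto
  then have "?u \<in> exponents a"
    using p q by (auto simp: exponents_def add_L scale_L)
  then show ?thesis
    using that \<open>w \<bullet> real_vec ?u = a w\<close> by blast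
qed

lemma exponents_nonempty: "exponents a \<noteq> {}"
proof -
  obtain q where q: "q \<in> L" "\<And>w. w \<in> T \<Longrightarrow> 1 \<le> w \<bullet> real_vec q"
    using interior_point by blast
  obtain n where "\<And>w. w \<in> T \<Longrightarrow> a w \<le> w \<bullet> real_vec (int n *s q)"
    by (rule interior_multiple[of T q "\<lambda>w. a w"]) (use q in auto)
  then have "int n *s q \<in> exponents a"
    using q by (simp add: exponents_def scale_L)
  then show ?thesis
    by blast
qed

text \<open>
  Any two monomials of a divisorial ideal have a common multiple by monomials of \<open>R\<close>, so the
  quotient \<open>\<phi>(f) / f\<close> is the same Laurent polynomial for all of them.
\<close>

lemma module_hom_is_mult:
  assumes add: "\<And>f g. f \<in> divisorial_ideal R a \<Longrightarrow> g \<in> divisorial_ideal R a \<Longrightarrow> \<phi> (f + g) = \<phi> f + \<phi> g"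
    and lin: "\<And>s f. s \<in> R \<Longrightarrow> f \<in> divisorial_ideal R a \<Longrightarrow> \<phi> (s * f) = s * \<phi> f"
  obtains h where "\<And>f. f \<in> divisorial_ideal R a \<Longrightarrow> \<phi> f = h * f"
proof -
  obtain m where m: "m \<in> exponents a"
    using exponents_nonempty by blast
  define h where "h = lmonom (- m) * \<phi> (lmonom m)"
  have lmonom_mult: "lmonom u * lmonom v = lmonom (u + v)" for u v :: "int ^ 'v"
    by (simp add: lmonom_def mult_single)
  have monomial: "\<phi> (lmonom u) = h * lmonom u" if u: "u \<in> exponents a" for u
  proof -
    have "u - m \<in> exp_group R"
      using u m by (simp add: exp_group_eq exponents_def diff_L)
    then obtain p q where pq: "u - m = p - q" "lmonom p \<in> R" "lmonom q \<in> R"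
      by (auto simp: exp_group_def exp_monoid_def)
    then have eq: "q + u = p + m"
      by (simp add: algebra_simps)
    have in_ideal: "lmonom u \<in> divisorial_ideal R a" "lmonom m \<in> divisorial_ideal R a"
      using u m by (auto simp: divisorial_ideal_eq lmonom_def)
    have "lmonom q * \<phi> (lmonom u) = lmonom p * \<phi> (lmonom m)"
      using lin[OF pq(3) in_ideal(1)] lin[OF pq(2) in_ideal(2)] by (simp add: lmonom_mult eq)
    then have "lmonom (- q) * (lmonom q * \<phi> (lmonom u)) = lmonom (- q) * (lmonom p * \<phi> (lmonom m))"
      by simp
    then have "lmonom 0 * \<phi> (lmonom u) = lmonom (p - q) * \<phi> (lmonom m)"
      by (simp add: lmonom_mult flip: mult.assoc)
    also have "lmonom (p - q) = lmonom (- m) * lmonom u"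
      using pq(1) by (simp add: lmonom_mult)
    finally show ?thesis
      by (simp add: h_def lmonom_def ac_simps)
  qed
  \<comment> \<open>The elements on which \<open>\<phi>\<close> is multiplication by
    \<open>h\<close> form an additively closed set that contains every term of
    \<open>f\<close>.\<close>
  have "f \<in> {f \<in> divisorial_ideal R a. \<phi> f = h * f}" if f: "f \<in> divisorial_ideal R a" for f
  proof (rule poly_mapping_in_closed)
    have zero: "0 \<in> divisorial_ideal R a"
      by (simp add: divisorial_ideal_eq)
    with add[OF zero zero] show "0 \<in> {f \<in> divisorial_ideal R a. \<phi> f = h * f}"
      by simp
    fix f g
    assume "f \<in> {f \<in> divisorial_ideal R a. \<phi> f = h * f}" "g \<in> {f \<in> divisorial_ideal R a. \<phi> f = h * f}"
    moreover from this have "f + g \<in> divisorial_ideal R a"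
      using Poly_Mapping.keys_add[of f g] unfolding divisorial_ideal_eq by blast
    ultimately show "f + g \<in> {f \<in> divisorial_ideal R a. \<phi> f = h * f}"
      using add[of f g] by (simp add: distrib_left)
  next
    fix u assume "u \<in> Poly_Mapping.keys f"
    then have u: "u \<in> exponents a"
      using f by (auto simp: divisorial_ideal_eq)
    let ?c = "Poly_Mapping.single 0 (Poly_Mapping.lookup f u) :: ('v, 'k) laurent"
    have eq: "Poly_Mapping.single u (Poly_Mapping.lookup f u) = ?c * lmonom u"
      by (simp add: lmonom_def mult_single)
    have "\<phi> (?c * lmonom u) = ?c * \<phi> (lmonom u)"
      using u by (intro lin single_in_R) (auto simp: zero_L divisorial_ideal_eq lmonom_def)
    then have "\<phi> (Poly_Mapping.single u (Poly_Mapping.lookup f u)) =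
        h * Poly_Mapping.single u (Poly_Mapping.lookup f u)"
      unfolding eq monomial[OF u] by (simp only: mult.left_commute)
    then show "Poly_Mapping.single u (Poly_Mapping.lookup f u) \<in> {f \<in> divisorial_ideal R a. \<phi> f = h * f}"
      using u by (simp add: divisorial_ideal_eq)
  qed
  then show ?thesis
    using that by blast
qed

text \<open>An isomorphism is multiplication by a Laurent polynomial \<open>h\<close>, and its
  inverse by some \<open>h'\<close> with \<open>h * h' = 1\<close>. Such a unit is a monomial up to
  a scalar, so the isomorphism translates exponents by a lattice vector \<open>u\<close>.\<close>

lemma module_iso_iff:
  "module_iso R (divisorial_ideal R a) (divisorial_ideal R b) \<longleftrightarrow>
    (\<exists>u\<in>L. \<forall>w\<in>T. real_of_int (b w) = a w + w \<bullet> real_vec u)"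
proof
  assume "\<exists>u\<in>L. \<forall>w\<in>T. real_of_int (b w) = a w + w \<bullet> real_vec u"
  then obtain u where u: "u \<in> L" "\<And>w. w \<in> T \<Longrightarrow> real_of_int (b w) = a w + w \<bullet> real_vec u"
    by blast
  have inverse: "lmonom (- u) * (lmonom u * f) = f" "lmonom u * (lmonom (- u) * f) = f"
    for f :: "('v, 'k) laurent"
    by (simp_all add: lmonom_def mult_single flip: mult.assoc)
  have ab: "u + v \<in> exponents b" if "v \<in> exponents a" for v
    using that u by (auto simp: exponents_def add_L real_vec_add inner_add_right)
  have ba: "v - u \<in> exponents a" if "v \<in> exponents b" for v
    using that u by (auto simp: exponents_def diff_L real_vec_diff inner_diff_right)
  have "bij_betw ((*) (lmonom u)) (divisorial_ideal R a) (divisorial_ideal R b)"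
  proof (rule bij_betw_byWitness[where f' = "(*) (lmonom (- u))"])
    show "(*) (lmonom u) ` divisorial_ideal R a \<subseteq> divisorial_ideal R b"
    proof (clarsimp simp: divisorial_ideal_eq)
      fix f :: "('v, 'k) laurent" and x
      assume "Poly_Mapping.keys f \<subseteq> exponents a" "x \<in> Poly_Mapping.keys (lmonom u * f)"
      then show "x \<in> exponents b"
        using keys_mult[of "lmonom u" f] ab by (auto simp: lmonom_def)
    qed
    show "(*) (lmonom (- u)) ` divisorial_ideal R b \<subseteq> divisorial_ideal R a"
    proof (clarsimp simp: divisorial_ideal_eq)
      fix f :: "('v, 'k) laurent" and x
      assume "Poly_Mapping.keys f \<subseteq> exponents b" "x \<in> Poly_Mapping.keys (lmonom (- u) * f)"
      then show "x \<in> exponents a"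
        using keys_mult[of "lmonom (- u)" f] ba by (fastforce simp: lmonom_def)
    qed
  qed (simp_all add: inverse)
  then show "module_iso R (divisorial_ideal R a) (divisorial_ideal R b)"
    unfolding module_iso_def by (intro exI[of _ "(*) (lmonom u)"]) (simp add: distrib_left ac_simps)
next
  assume "module_iso R (divisorial_ideal R a) (divisorial_ideal R b)"
  then obtain \<phi> where bij: "bij_betw \<phi> (divisorial_ideal R a) (divisorial_ideal R b)"
    and add: "\<And>f g. f \<in> divisorial_ideal R a \<Longrightarrow> g \<in> divisorial_ideal R a \<Longrightarrow> \<phi> (f + g) = \<phi> f + \<phi> g"
    and lin: "\<And>s f. s \<in> R \<Longrightarrow> f \<in> divisorial_ideal R a \<Longrightarrow> \<phi> (s * f) = s * \<phi> f"
    unfolding module_iso_def by blast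
  define \<psi> where "\<psi> = the_inv_into (divisorial_ideal R a) \<phi>"
  have \<psi>: "\<psi> g \<in> divisorial_ideal R a" "\<phi> (\<psi> g) = g" if "g \<in> divisorial_ideal R b" for g
    using that bij unfolding \<psi>_def
    by (auto simp: bij_betw_def f_the_inv_into_f intro: the_inv_into_into)
  have \<phi>: "\<phi> f \<in> divisorial_ideal R b" "\<psi> (\<phi> f) = f" if "f \<in> divisorial_ideal R a" for f
    using that bij unfolding \<psi>_def by (auto simp: bij_betw_def the_inv_into_f_f)
  have sum: "f + g \<in> divisorial_ideal R c" if "f \<in> divisorial_ideal R c" "g \<in> divisorial_ideal R c" for f g c
    using that Poly_Mapping.keys_add[of f g] by (auto simp: divisorial_ideal_eq)
  have times: "s * f \<in> divisorial_ideal R c" if "s \<in> R" "f \<in> divisorial_ideal R c" for s f c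
    using that keys_times_R by (auto simp: divisorial_ideal_eq)
  obtain h where h: "\<And>f. f \<in> divisorial_ideal R a \<Longrightarrow> \<phi> f = h * f"
    using module_hom_is_mult[of a \<phi>] add lin by blast
  \<comment> \<open>The inverse is again a module homomorphism, hence a multiplication; comparing at
    a single monomial shows that the two factors are inverse to each other.\<close>
  have "\<psi> (f + g) = \<psi> f + \<psi> g" if "f \<in> divisorial_ideal R b" "g \<in> divisorial_ideal R b" for f g
    using add[of "\<psi> f" "\<psi> g"] \<psi>[OF that(1)] \<psi>[OF that(2)] \<phi>(2)[of "\<psi> f + \<psi> g"] sum[of "\<psi> f" a "\<psi> g"]
    by simp
  moreover have "\<psi> (s * f) = s * \<psi> f" if "s \<in> R" "f \<in> divisorial_ideal R b" for s f
    using lin[of s "\<psi> f"] \<psi>[OF that(2)] \<phi>(2)[of "s * \<psi> f"] times[of s "\<psi> f" a] that(1) by simp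
  ultimately obtain h' where h': "\<And>g. g \<in> divisorial_ideal R b \<Longrightarrow> \<psi> g = h' * g"
    using module_hom_is_mult[of b \<psi>] by blast
  obtain m where m: "m \<in> exponents a"
    using exponents_nonempty by blast
  have "lmonom m \<in> divisorial_ideal R a"
    using m by (auto simp: divisorial_ideal_eq lmonom_def)
  then have "h' * (h * lmonom m) = lmonom m"
    using h h' \<phi> by metis
  then have "h' * (h * lmonom m) * lmonom (- m) = lmonom m * lmonom (- m)"
    by simp
  then have hh': "h * h' = 1"
    by (simp add: lmonom_def mult_single ac_simps)
  obtain u c where u: "h = Poly_Mapping.single u c" "c \<noteq> 0"
    using laurent_unit[OF hh'] by blast
  obtain u' c' where u': "h' = Poly_Mapping.single u' c'" "c' \<noteq> 0"
    using laurent_unit[of h' h] hh' by (metis mult.commute)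
  have "Poly_Mapping.keys (h * h') = {u + u'}"
    using u u' by (simp add: mult_single)
  then have "u' = - u"
    by (simp add: hh' eq_neg_iff_add_eq_0 add.commute)
  have ab: "u + v \<in> exponents b" if "v \<in> exponents a" for v
  proof -
    have "lmonom v \<in> divisorial_ideal R a"
      using that by (auto simp: divisorial_ideal_eq lmonom_def)
    then have "h * lmonom v \<in> divisorial_ideal R b"
      using h \<phi> by metis
    then show ?thesis
      using u by (simp add: divisorial_ideal_eq lmonom_def mult_single)
  qed
  have ba: "v - u \<in> exponents a" if "v \<in> exponents b" for v
  proof -
    have "lmonom v \<in> divisorial_ideal R b"
      using that by (auto simp: divisorial_ideal_eq lmonom_def)
    then have "h' * lmonom v \<in> divisorial_ideal R a"
      using h' \<psi> by metis
    then show ?thesis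
      using u' \<open>u' = - u\<close> by (simp add: divisorial_ideal_eq lmonom_def mult_single)
  qed
  have "u \<in> L"
    using ab[OF m] m diff_L[of "u + m" m] by (simp add: exponents_def)
  \<comment> \<open>\<open>a w\<close> and \<open>b w\<close> are the least values of
    \<open>w\<close> on the two exponent sets, and these are translates of each other by
    \<open>u\<close>.\<close>
  moreover have "real_of_int (b w) = a w + w \<bullet> real_vec u" if w: "w \<in> T" for w
  proof (rule antisym)
    obtain v where v: "v \<in> exponents a" "w \<bullet> real_vec v = a w"
      using exponents_attained[OF w] by blast
    then show "real_of_int (b w) \<le> a w + w \<bullet> real_vec u"
      using ab[OF v(1)] w by (auto simp: exponents_def real_vec_add inner_add_right)
    obtain v where v: "v \<in> exponents b" "w \<bullet> real_vec v = b w"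
      using exponents_attained[OF w] by blast
    then show "a w + w \<bullet> real_vec u \<le> real_of_int (b w)"
      using ba[OF v(1)] w by (auto simp: exponents_def real_vec_diff inner_diff_right)
  qed
  ultimately show "\<exists>u\<in>L. \<forall>w\<in>T. real_of_int (b w) = a w + w \<bullet> real_vec u"
    by blast
qed

lemma conic_divisorial_ideals_eq:
  "conic_divisorial_ideals R = range (\<lambda>x. divisorial_ideal R (\<lambda>w. \<lceil>w \<bullet> x\<rceil>))"
proof -
  have cong: "divisorial_ideal R a = divisorial_ideal R b" if "\<forall>w\<in>T. a w = b w" for a b
    using that by (auto simp: divisorial_ideal_eq exponents_def)
  show ?thesis
  proof (intro equalityI subsetI)
    fix M assume "M \<in> conic_divisorial_ideals R"
    then obtain a x where "M = divisorial_ideal R a" "\<forall>w\<in>T. a w = \<lceil>w \<bullet> x\<rceil>"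
      unfolding conic_divisorial_ideals_def exp_space_eq facet_forms_eq by blast
    then show "M \<in> range (\<lambda>x. divisorial_ideal R (\<lambda>w. \<lceil>w \<bullet> x\<rceil>))"
      using cong[of a "\<lambda>w. \<lceil>w \<bullet> x\<rceil>"] by (intro range_eqI[of _ _ x]) simp
  next
    fix M assume "M \<in> range (\<lambda>x. divisorial_ideal R (\<lambda>w. \<lceil>w \<bullet> x\<rceil>))"
    then show "M \<in> conic_divisorial_ideals R"
      unfolding conic_divisorial_ideals_def exp_space_eq facet_forms_eq by blast
  qed
qed

end

subsection \<open>The polytope for three and four parts\<close>

lemma ex_between_finite_sets:
  fixes A B :: "real set"
  assumes "finite A" "A \<noteq> {}" "finite B" "B \<noteq> {}" and less: "\<And>a b. a \<in> A \<Longrightarrow> b \<in> B \<Longrightarrow> a < b"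
  obtains s where "\<And>a. a \<in> A \<Longrightarrow> a < s" "\<And>b. b \<in> B \<Longrightarrow> s < b"
proof -
  have "Max A < Min B"
    using assms by (intro less) auto
  then obtain s where "Max A < s" "s < Min B"
    using dense by blast
  then show ?thesis
    using assms that by (metis Max_less_iff Min_gr_iff)
qed

text \<open>All coordinates move from \<open>lo\<close> to \<open>up\<close> with one common
  parameter \<open>c\<close>, chosen so that the total is \<open>t\<close>.\<close>

lemma ex_sum_eq_between:
  fixes lo up :: "'a \<Rightarrow> real"
  assumes "finite A" and less: "\<And>i. i \<in> A \<Longrightarrow> lo i < up i" and t: "sum lo A < t" "t < sum up A"
  obtains F where "\<And>i. i \<in> A \<Longrightarrow> lo i < F i \<and> F i < up i" "sum F A = t"
proof -
  define c where "c = (t - sum lo A) / (sum up A - sum lo A)"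
  define F where "F i = lo i + c * (up i - lo i)" for i
  have c: "0 < c" "c < 1"
    using t by (simp_all add: c_def field_simps)
  have "lo i < F i \<and> F i < up i" if "i \<in> A" for i
  proof -
    have "0 < c * (up i - lo i)" "c * (up i - lo i) < 1 * (up i - lo i)"
      using less[OF that] c by (auto intro!: mult_strict_right_mono)
    then show ?thesis
      by (simp add: F_def)
  qed
  moreover have "sum F A = sum lo A + c * (sum up A - sum lo A)"
    by (simp add: F_def sum.distrib flip: sum_distrib_left sum_subtractf)
  then have "sum F A = t"
    using t by (simp add: c_def)
  ultimately show ?thesis
    using that by blast
qed

text \<open>
  Choosing one of the two arguments in each \<open>max\<close> or \<open>min\<close> turns the two inequalities for \<open>s\<close>
  into linear ones. Those in which \<open>s\<close> does not cancel, together with the bounds on the single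
  \<open>y\<^sub>i + s\<close>, put \<open>s\<close> above the elements of \<open>?A\<close> and below those of \<open>?B\<close>.
\<close>

lemma tripartite_shift:
  fixes y1 y2 y3 r1 r2 r3 :: real
  assumes "1 \<le> r1" "1 \<le> r2" "1 \<le> r3"
    and "y2 - y1 \<le> r2" "y3 - y1 \<le> r3" "y1 - y2 \<le> r1" "y3 - y2 \<le> r3" "y1 - y3 \<le> r1" "y2 - y3 \<le> r2"
    and "y1 + y2 \<le> 1" "y1 + y3 \<le> 1" "y2 + y3 \<le> 1"
    and "1 - r3 \<le> y1 + y2" "1 - r2 \<le> y1 + y3" "1 - r1 \<le> y2 + y3"
  obtains s where "0 < y1 + s" "0 < y2 + s" "0 < y3 + s"
    "y1 + s - 1 < r1" "y2 + s - 1 < r2" "y3 + s - 1 < r3"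
    "max 0 (y1 + s - 1) + max 0 (y2 + s - 1) + max 0 (y3 + s - 1) < 2 * s"
    "2 * s < min r1 (y1 + s) + min r2 (y2 + s) + min r3 (y3 + s)"
proof -
  let ?A = "{0, - y1, - y2, - y3, y1 - 1, y2 - 1, y3 - 1, - y1 - y2 - y3}"
  let ?B = "{r1 + 1 - y1, r2 + 1 - y2, r3 + 1 - y3, 3 - y1 - y2 - y3, r1 / 2 + r2 / 2 + r3 / 2,
    y1 + r2 + r3, y2 + r1 + r3, y3 + r1 + r2}"
  obtain s where s: "\<And>a. a \<in> ?A \<Longrightarrow> a < s" "\<And>b. b \<in> ?B \<Longrightarrow> s < b"
  proof (rule ex_between_finite_sets[of ?A ?B])
    have "\<forall>a\<in>?A. \<forall>b\<in>?B. a < b"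
      unfolding ball_simps simp_thms by (intro conjI; use assms in linarith)
    then show "a < b" if "a \<in> ?A" "b \<in> ?B" for a b
      using that by blast
  qed auto
  have A: "0 < s" "- y1 < s" "- y2 < s" "- y3 < s" "y1 - 1 < s" "y2 - 1 < s" "y3 - 1 < s"
    "- y1 - y2 - y3 < s"
    by (rule s; simp)+
  have B: "s < r1 + 1 - y1" "s < r2 + 1 - y2" "s < r3 + 1 - y3" "s < 3 - y1 - y2 - y3"
    "s < r1 / 2 + r2 / 2 + r3 / 2" "s < y1 + r2 + r3" "s < y2 + r1 + r3" "s < y3 + r1 + r2"
    by (rule s; simp)+
  show ?thesis
  proof (rule that[of s])
    show "max 0 (y1 + s - 1) + max 0 (y2 + s - 1) + max 0 (y3 + s - 1) < 2 * s"
      using A B assms(10-12) by linarith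
    show "2 * s < min r1 (y1 + s) + min r2 (y2 + s) + min r3 (y3 + s)"
      using A B assms(1-3,13-15) by linarith
  qed (use A B in linarith)+
qed

text \<open>A sum of positive parts is the largest subset sum; the hypotheses bound the sums over
  all sixteen subsets.\<close>

lemma sum_max_0_less:
  fixes a b c d t :: real
  assumes "0 < t" "a < t" "b < t" "c < t" "d < t" "a + b < t" "a + c < t" "a + d < t" "b + c < t"
    "b + d < t" "c + d < t" "a + b + c < t" "a + b + d < t" "a + c + d < t" "b + c + d < t"
    "a + b + c + d < t"
  shows "max 0 a + max 0 b + max 0 c + max 0 d < t"
  using assms by (simp add: max_def)

lemma quadripartite_shift:
  fixes y1 y2 y3 y4 r1 r2 r3 r4 :: real
  assumes "1 \<le> r1" "1 \<le> r2" "1 \<le> r3" "1 \<le> r4"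
    and "y2 - y1 \<le> r2" "y3 - y1 \<le> r3" "y4 - y1 \<le> r4" "y1 - y2 \<le> r1" "y3 - y2 \<le> r3" "y4 - y2 \<le> r4"
      "y1 - y3 \<le> r1" "y2 - y3 \<le> r2" "y4 - y3 \<le> r4" "y1 - y4 \<le> r1" "y2 - y4 \<le> r2" "y3 - y4 \<le> r3"
    and "y1 + y2 \<le> 1" "y1 + y3 \<le> 1" "y1 + y4 \<le> 1" "y2 + y3 \<le> 1" "y2 + y4 \<le> 1" "y3 + y4 \<le> 1"
    and "1 - r3 - r4 \<le> y1 + y2" "1 - r2 - r4 \<le> y1 + y3" "1 - r2 - r3 \<le> y1 + y4"
      "1 - r1 - r4 \<le> y2 + y3" "1 - r1 - r3 \<le> y2 + y4" "1 - r1 - r2 \<le> y3 + y4"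
    and "y2 + y3 + y4 - y1 \<le> 2" "y1 + y3 + y4 - y2 \<le> 2" "y1 + y2 + y4 - y3 \<le> 2" "y1 + y2 + y3 - y4 \<le> 2"
    and "- 2 * r1 \<le> y2 + y3 + y4 - y1" "- 2 * r2 \<le> y1 + y3 + y4 - y2"
      "- 2 * r3 \<le> y1 + y2 + y4 - y3" "- 2 * r4 \<le> y1 + y2 + y3 - y4"
  obtains s where "0 < y1 + s" "0 < y2 + s" "0 < y3 + s" "0 < y4 + s"
    "y1 + s - 1 < r1" "y2 + s - 1 < r2" "y3 + s - 1 < r3" "y4 + s - 1 < r4"
    "max 0 (y1 + s - 1) + max 0 (y2 + s - 1) + max 0 (y3 + s - 1) + max 0 (y4 + s - 1) < 2 * s"
    "2 * s < min r1 (y1 + s) + min r2 (y2 + s) + min r3 (y3 + s) + min r4 (y4 + s)"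
proof -
  let ?A = "{0, - y1, - y2, - y3, - y4, y1 - 1, y2 - 1, y3 - 1, y4 - 1,
    - y2 - y3 - y4 - r1, - y1 - y3 - y4 - r2, - y1 - y2 - y4 - r3, - y1 - y2 - y3 - r4,
    - y1 / 2 - y2 / 2 - y3 / 2 - y4 / 2}"
  let ?B = "{r1 + 1 - y1, r2 + 1 - y2, r3 + 1 - y3, r4 + 1 - y4,
    3 - y2 - y3 - y4, 3 - y1 - y3 - y4, 3 - y1 - y2 - y4, 3 - y1 - y2 - y3,
    2 - y1 / 2 - y2 / 2 - y3 / 2 - y4 / 2, r1 / 2 + r2 / 2 + r3 / 2 + r4 / 2,
    y1 + r2 + r3 + r4, y2 + r1 + r3 + r4, y3 + r1 + r2 + r4, y4 + r1 + r2 + r3}"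
  obtain s where s: "\<And>a. a \<in> ?A \<Longrightarrow> a < s" "\<And>b. b \<in> ?B \<Longrightarrow> s < b"
  proof (rule ex_between_finite_sets[of ?A ?B])
    \<comment> \<open>The bounds of three coordinates against one enter here. For instance,
      \<open>- y1 < 3 - y2 - y3 - y4\<close> follows from the upper bound on
      \<open>y2 + y3 + y4 - y1\<close>, and \<open>- y2 - y3 - y4 - r1 < r1 + 1 - y1\<close> from
      the lower one.\<close>
    have "\<forall>a\<in>?A. \<forall>b\<in>?B. a < b"
      unfolding ball_simps simp_thms by (intro conjI; use assms in linarith)
    then show "a < b" if "a \<in> ?A" "b \<in> ?B" for a b
      using that by blast
  qed auto
  have A: "0 < s" "- y1 < s" "- y2 < s" "- y3 < s" "- y4 < s" "y1 - 1 < s" "y2 - 1 < s" "y3 - 1 < s"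
    "y4 - 1 < s" "- y2 - y3 - y4 - r1 < s" "- y1 - y3 - y4 - r2 < s" "- y1 - y2 - y4 - r3 < s"
    "- y1 - y2 - y3 - r4 < s" "- y1 / 2 - y2 / 2 - y3 / 2 - y4 / 2 < s"
    by (rule s; simp)+
  have B: "s < r1 + 1 - y1" "s < r2 + 1 - y2" "s < r3 + 1 - y3" "s < r4 + 1 - y4"
    "s < 3 - y2 - y3 - y4" "s < 3 - y1 - y3 - y4" "s < 3 - y1 - y2 - y4" "s < 3 - y1 - y2 - y3"
    "s < 2 - y1 / 2 - y2 / 2 - y3 / 2 - y4 / 2" "s < r1 / 2 + r2 / 2 + r3 / 2 + r4 / 2"
    "s < y1 + r2 + r3 + r4" "s < y2 + r1 + r3 + r4" "s < y3 + r1 + r2 + r4" "s < y4 + r1 + r2 + r3"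
    by (rule s; simp)+
  show ?thesis
  proof (rule that[of s])
    show "max 0 (y1 + s - 1) + max 0 (y2 + s - 1) + max 0 (y3 + s - 1) + max 0 (y4 + s - 1) < 2 * s"
      by (rule sum_max_0_less; use A(1,6-9) B(5-9) assms(17-22) in linarith)
    \<comment> \<open>Subtracting both sides from the sum of the \<open>yi + s\<close> turns this
      into the bound on the minima, since \<open>min r y = y - max 0 (y - r)\<close>; so the
      subset-sum criterion serves twice.\<close>
    have "max 0 (y1 + s - r1) + max 0 (y2 + s - r2) + max 0 (y3 + s - r3) + max 0 (y4 + s - r4)
        < y1 + y2 + y3 + y4 + 2 * s"
      by (rule sum_max_0_less; use A(10-14) B(10-14) assms(23-28) in linarith)
    moreover have "min r y = y - max 0 (y - r)" for r y :: real
      by (simp add: min_def max_def)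
    ultimately show "2 * s < min r1 (y1 + s) + min r2 (y2 + s) + min r3 (y3 + s) + min r4 (y4 + s)"
      by simp
  qed (use A B in linarith)+
qed

section \<open>Integer points of the polytope and rounding errors\<close>

lemma ex_shift:
  fixes y r :: "nat \<Rightarrow> real"
  assumes n: "n = 3 \<or> n = 4" and r: "\<And>i. i \<in> {1..n} \<Longrightarrow> 1 \<le> r i"
    and diff: "\<And>i j. i \<in> {1..n} \<Longrightarrow> j \<in> {1..n} \<Longrightarrow> y j - y i \<le> r j"
    and pair: "\<And>i j. i \<in> {1..n} \<Longrightarrow> j \<in> {1..n} \<Longrightarrow> i \<noteq> j \<Longrightarrow>
      1 - sum r ({1..n} - {i, j}) \<le> y i + y j \<and> y i + y j \<le> 1"
    and triple: "\<And>i. n = 4 \<Longrightarrow> i \<in> {1..n} \<Longrightarrow>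
      - 2 * r i \<le> sum y ({1..n} - {i}) - y i \<and> sum y ({1..n} - {i}) - y i \<le> 2"
  obtains s where "\<And>i. i \<in> {1..n} \<Longrightarrow> 0 < y i + s \<and> y i + s - 1 < r i"
    "(\<Sum>i\<in>{1..n}. max 0 (y i + s - 1)) < 2 * s"
    "2 * s < (\<Sum>i\<in>{1..n}. min (r i) (y i + s))"
proof (cases "n = 3")
  case True
  have *: "{1..n} = {1, 2, 3}"
    using True by auto
  have ge1: "1 \<le> r 1" "1 \<le> r 2" "1 \<le> r 3"
    using r unfolding * by auto
  have diffs: "y 2 - y 1 \<le> r 2" "y 3 - y 1 \<le> r 3" "y 1 - y 2 \<le> r 1"
    "y 3 - y 2 \<le> r 3" "y 1 - y 3 \<le> r 1" "y 2 - y 3 \<le> r 2"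
    using diff unfolding * by auto
  have pairs: "y 1 + y 2 \<le> 1" "y 1 + y 3 \<le> 1" "y 2 + y 3 \<le> 1"
    "1 - r 3 \<le> y 1 + y 2" "1 - r 2 \<le> y 1 + y 3" "1 - r 1 \<le> y 2 + y 3"
    using pair[of 1 2] pair[of 1 3] pair[of 2 3]
    unfolding * by (simp_all add: insert_Diff_if del: One_nat_def)
  obtain s where s: "0 < y 1 + s" "0 < y 2 + s" "0 < y 3 + s" "y 1 + s - 1 < r 1"
    "y 2 + s - 1 < r 2" "y 3 + s - 1 < r 3"
    "max 0 (y 1 + s - 1) + max 0 (y 2 + s - 1) + max 0 (y 3 + s - 1) < 2 * s"
    "2 * s < min (r 1) (y 1 + s) + min (r 2) (y 2 + s) + min (r 3) (y 3 + s)"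
    using tripartite_shift[OF ge1 diffs pairs] by blast
  show ?thesis
    by (rule that[of s]) (use s in \<open>auto simp: * simp del: One_nat_def\<close>)
next
  case False
  then have n4: "n = 4" and *: "{1..n} = {1, 2, 3, 4}"
    using n by auto
  have ge1: "1 \<le> r 1" "1 \<le> r 2" "1 \<le> r 3" "1 \<le> r 4"
    using r unfolding * by auto
  have diffs: "y 2 - y 1 \<le> r 2" "y 3 - y 1 \<le> r 3" "y 4 - y 1 \<le> r 4"
    "y 1 - y 2 \<le> r 1" "y 3 - y 2 \<le> r 3" "y 4 - y 2 \<le> r 4" "y 1 - y 3 \<le> r 1"
    "y 2 - y 3 \<le> r 2" "y 4 - y 3 \<le> r 4" "y 1 - y 4 \<le> r 1" "y 2 - y 4 \<le> r 2"
    "y 3 - y 4 \<le> r 3"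
    using diff unfolding * by auto
  have pairs: "y 1 + y 2 \<le> 1" "y 1 + y 3 \<le> 1" "y 1 + y 4 \<le> 1" "y 2 + y 3 \<le> 1"
    "y 2 + y 4 \<le> 1" "y 3 + y 4 \<le> 1"
    "1 - r 3 - r 4 \<le> y 1 + y 2" "1 - r 2 - r 4 \<le> y 1 + y 3"
    "1 - r 2 - r 3 \<le> y 1 + y 4" "1 - r 1 - r 4 \<le> y 2 + y 3"
    "1 - r 1 - r 3 \<le> y 2 + y 4" "1 - r 1 - r 2 \<le> y 3 + y 4"
    using pair[of 1 2] pair[of 1 3] pair[of 1 4] pair[of 2 3] pair[of 2 4] pair[of 3 4]
    unfolding * by (simp_all add: insert_Diff_if del: One_nat_def)
  have triples: "y 2 + y 3 + y 4 - y 1 \<le> 2" "y 1 + y 3 + y 4 - y 2 \<le> 2"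
    "y 1 + y 2 + y 4 - y 3 \<le> 2" "y 1 + y 2 + y 3 - y 4 \<le> 2"
    "- 2 * r 1 \<le> y 2 + y 3 + y 4 - y 1" "- 2 * r 2 \<le> y 1 + y 3 + y 4 - y 2"
    "- 2 * r 3 \<le> y 1 + y 2 + y 4 - y 3" "- 2 * r 4 \<le> y 1 + y 2 + y 3 - y 4"
    using triple[OF n4, of 1] triple[OF n4, of 2] triple[OF n4, of 3] triple[OF n4, of 4]
    unfolding * by (simp_all add: insert_Diff_if del: One_nat_def)
  obtain s where s: "0 < y 1 + s" "0 < y 2 + s" "0 < y 3 + s" "0 < y 4 + s" "y 1 + s - 1 < r 1"
    "y 2 + s - 1 < r 2" "y 3 + s - 1 < r 3" "y 4 + s - 1 < r 4"
    "max 0 (y 1 + s - 1) + max 0 (y 2 + s - 1) + max 0 (y 3 + s - 1) + max 0 (y 4 + s - 1) < 2 * s"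
    "2 * s < min (r 1) (y 1 + s) + min (r 2) (y 2 + s) + min (r 3) (y 3 + s) + min (r 4) (y 4 + s)"
    using quadripartite_shift[OF ge1 diffs pairs triples] by blast
  show ?thesis
    by (rule that[of s]) (use s in \<open>auto simp: * simp del: One_nat_def\<close>)
qed

text \<open>After the change to the coordinates \<open>y\<close>, suitable choices of
  \<open>I\<close> and \<open>J\<close> in the polytope inequalities give all hypotheses needed for
  a shift \<open>s\<close>; then \<open>F\<close> is interpolated with total \<open>2 * s\<close>,
  and \<open>g\<close> is what remains.\<close>

lemma polytope_point_decomposition:
  assumes n: "n = 3 \<or> n = 4" and r: "\<And>i. i \<in> {1..n} \<Longrightarrow> 1 \<le> r i"
    and z: "z \<in> multipartite_polytope n r"
  obtains F g :: "nat \<Rightarrow> real"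
    where "\<And>i. i \<in> {1..n} \<Longrightarrow> 0 \<le> F i \<and> F i < r i" "\<And>i. i \<in> {1..n} \<Longrightarrow> 0 \<le> g i \<and> g i < 1"
      "\<And>i. i \<in> {1..n} \<Longrightarrow> z i = g i + g n + F i + F n - sum F {1..n}"
proof -
  \<comment> \<open>This solves \<open>z i = y i + y n\<close>, whose case \<open>i = n\<close>
    reads \<open>z n = 2 * y n\<close>.\<close>
  define y where "y i = z i - z n / 2" for i
  note z' = z[unfolded multipartite_polytope_def mem_Collect_eq, THEN conjunct2]
  have diff: "z j - z i \<le> r j" if "i \<in> {1..n}" "j \<in> {1..n}" for i j
    using z'[THEN conjunct1, rule_format, OF that] by simp
  have low: "1 - real (size J) - (\<Sum>i\<in>{1..n-1} - I. real (r i)) - (\<Sum>j\<in>#J. real (r j))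
      \<le> (\<Sum>i\<in>I. z i) - (\<Sum>j\<in>#J. z j) \<and> (\<Sum>i\<in>I. z i) - (\<Sum>j\<in>#J. z j) \<le> 1 + real (size J)"
    if "I \<subseteq> {1..n-1}" "set_mset J \<subseteq> {1..n-1}" "card I = size J + 1" "I \<inter> set_mset J = {}" for I J
    using z'[THEN conjunct2, THEN conjunct1, rule_format, of I J] that by simp
  have high: "2 - real (size J) - (\<Sum>i\<in>{1..n-1} - I. real (r i)) - (\<Sum>j\<in>#J. real (r j))
      \<le> (\<Sum>i\<in>I. z i) - (\<Sum>j\<in>#J. z j) \<and> (\<Sum>i\<in>I. z i) - (\<Sum>j\<in>#J. z j) \<le> real (size J)"
    if "I \<subseteq> {1..n-1}" "set_mset J \<subseteq> {1..n}" "card I = size J + 1" "n \<in># J" "I \<inter> set_mset J = {}" for I J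
    using z'[THEN conjunct2, THEN conjunct2, rule_format, of I J] that by simp
  have up: "{1..2::nat} = {1, 2}" "{1..3::nat} = {1, 2, 3}" "{1..4::nat} = {1, 2, 3, 4}"
    by auto
  obtain s where s: "\<And>i. i \<in> {1..n} \<Longrightarrow> 0 < y i + s \<and> y i + s - 1 < r i"
    "(\<Sum>i\<in>{1..n}. max 0 (y i + s - 1)) < 2 * s" "2 * s < (\<Sum>i\<in>{1..n}. min (r i) (y i + s))"
  proof (rule ex_shift[OF n, of "\<lambda>i. real (r i)" y])
    show "1 \<le> real (r i)" if "i \<in> {1..n}" for i
      using r[OF that] by simp
    show "y j - y i \<le> real (r j)" if "i \<in> {1..n}" "j \<in> {1..n}" for i j
      using diff[OF that] by (simp add: y_def)
    show "1 - (\<Sum>i\<in>{1..n} - {i, j}. real (r i)) \<le> y i + y j \<and> y i + y j \<le> 1"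
      if "i \<in> {1..n}" "j \<in> {1..n}" "i \<noteq> j" for i j
    proof -
      \<comment> \<open>A pair containing \<open>n\<close> is a single coordinate
        \<open>z i\<close>, so \<open>J\<close> is empty. For other pairs
        \<open>y i + y j = z i + z j - z n\<close>, which calls for
        \<open>J = {#n#}\<close>.\<close>
      have *: "1 - (\<Sum>i\<in>{1..n} - {i, n}. real (r i)) \<le> y i + y n \<and> y i + y n \<le> 1"
        if "i \<in> {1..n-1}" for i
      proof -
        have "{1..n-1} - {i} = {1..n} - {i, n}"
          by auto
        then show ?thesis
          using low[of "{i}" "{#}"] that by (simp add: y_def)
      qed
      have **: "1 - (\<Sum>i\<in>{1..n} - {i, j}. real (r i)) \<le> y i + y j \<and> y i + y j \<le> 1"
        if "i \<in> {1..n-1}" "j \<in> {1..n-1}" "i \<noteq> j"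
      proof -
        have "{1..n} - {i, j} = insert n ({1..n-1} - {i, j})" "n \<notin> {1..n-1} - {i, j}"
          using that by auto
        moreover have less: "i < n" "j < n"
          using that n by auto
        ultimately have "(\<Sum>i\<in>{1..n} - {i, j}. real (r i)) = r n + (\<Sum>i\<in>{1..n-1} - {i, j}. real (r i))"
          by simp
        with less show ?thesis
          using high[of "{i, j}" "{#n#}"] that by (auto simp: y_def)
      qed
      consider "i = n" "j \<in> {1..n-1}" | "j = n" "i \<in> {1..n-1}" | "i \<in> {1..n-1}" "j \<in> {1..n-1}"
        using \<open>i \<in> {1..n}\<close> \<open>j \<in> {1..n}\<close> \<open>i \<noteq> j\<close> by fastforce
      then show ?thesis
        using *[of i] *[of j] ** \<open>i \<noteq> j\<close> by cases (simp_all add: insert_commute add.commute)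
    qed
    \<comment> \<open>For \<open>i < 4\<close>, the two other indices below 4 form \<open>I\<close>
      and \<open>J = {#i#}\<close>: each side contributes copies of \<open>y 4\<close>, of which
      exactly one survives.\<close>
    show "- 2 * real (r i) \<le> sum y ({1..n} - {i}) - y i \<and> sum y ({1..n} - {i}) - y i \<le> 2"
      if n4: "n = 4" and "i \<in> {1..n}" for i
    proof -
      consider "i = 1" | "i = 2" | "i = 3" | "i = 4"
        using \<open>i \<in> {1..n}\<close> unfolding n4 up by blast
      then show ?thesis
      proof cases
        case 1
        with low[of "{2, 3}" "{#1#}"] n4 show ?thesis
          by (simp add: up y_def insert_Diff_if del: One_nat_def)
      next
        case 2
        with low[of "{1, 3}" "{#2#}"] n4 show ?thesis
          by (simp add: up y_def insert_Diff_if del: One_nat_def)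
      next
        case 3
        with low[of "{1, 2}" "{#3#}"] n4 show ?thesis
          by (simp add: up y_def insert_Diff_if del: One_nat_def)
      next
        case 4
        \<comment> \<open>Three copies of \<open>y 4\<close> come from \<open>I\<close>, and
          \<open>z 4\<close> is \<open>2 * y 4\<close>; taking 4 twice in \<open>J\<close> leaves
          \<open>- y 4\<close>. Here \<open>J\<close> has to be a genuine multiset.\<close>
        with high[of "{1, 2, 3}" "{#4, 4#}"] n4 show ?thesis
          by (simp add: up y_def insert_Diff_if del: One_nat_def)
      qed
    qed
  qed blast
  obtain F where F: "\<And>i. i \<in> {1..n} \<Longrightarrow> max 0 (y i + s - 1) < F i \<and> F i < min (real (r i)) (y i + s)"
    "sum F {1..n} = 2 * s"
  proof (rule ex_sum_eq_between[OF _ _ s(2,3)])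
    show "max 0 (y i + s - 1) < min (real (r i)) (y i + s)" if "i \<in> {1..n}" for i
      using s(1)[OF that] r[OF that] by auto
  qed auto
  have "n \<in> {1..n}"
    using n by auto
  \<comment> \<open>The bounds \<open>y i + s - 1 < F i < y i + s\<close> say precisely that
    \<open>g i = y i + s - F i\<close> lies strictly between 0 and 1.\<close>
  show ?thesis
  proof (rule that[of F "\<lambda>i. y i + s - F i"])
    show "z i = y i + s - F i + (y n + s - F n) + F i + F n - sum F {1..n}" for i
      using F(2) by (simp add: y_def)
  qed (use F(1) in force)+
qed

lemma Ints_le_of_less_add_1:
  fixes x y :: "'a::linordered_idom"
  assumes "x \<in> \<int>" "y \<in> \<int>" "x < y + 1"
  shows "x \<le> y"
proof -
  obtain k l where "x = of_int k" "y = of_int l"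
    using assms by (auto elim!: Ints_cases)
  moreover have "of_int k < (of_int (l + 1) :: 'a) \<Longrightarrow> k \<le> l"
    by (simp only: of_int_less_iff)
  ultimately show ?thesis
    using assms(3) by simp
qed

text \<open>Each combination of coordinates is strictly bounded through the ranges of
  \<open>F\<close> and \<open>g\<close>. Both it and the bounds are integers, so every strict
  inequality sharpens by one.\<close>

lemma in_polytope_of_decomposition:
  fixes F g z :: "nat \<Rightarrow> real"
  assumes n: "3 \<le> n"
    and F: "\<And>i. i \<in> {1..n} \<Longrightarrow> 0 \<le> F i \<and> F i < r i" and g: "\<And>i. i \<in> {1..n} \<Longrightarrow> 0 \<le> g i \<and> g i < 1"
    and z: "\<And>i. i \<in> {1..n} \<Longrightarrow> z i = g i + g n + F i + F n - sum F {1..n}"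
    and int: "z \<in> integer_points n"
  shows "z \<in> multipartite_polytope n r"
proof -
  have nn: "n \<in> {1..n}"
    using n by simp
  have zZ: "z i \<in> \<int>" if "i \<in> {1..n}" for i
    using int that by (auto simp: integer_points_def)
  have differences: "- real (r i) \<le> z j - z i \<and> z j - z i \<le> real (r j)" if "i \<in> {1..n}" "j \<in> {1..n}" for i j
  proof -
    have "- real (r i) < z j - z i + 1" "z j - z i < real (r j) + 1"
      using z[OF that(1)] z[OF that(2)] F[OF that(1)] F[OF that(2)] g[OF that(1)] g[OF that(2)] by linarith+
    then show ?thesis
      using zZ[OF that(1)] zZ[OF that(2)] by (intro conjI Ints_le_of_less_add_1) auto
  qed
  have val: "(\<Sum>i\<in>I. z i) - (\<Sum>j\<in>#J. z j) =
      sum g I - (\<Sum>j\<in>#J. g j + F j) + g n - sum F ({1..n-1} - I)"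
    and integral: "(\<Sum>i\<in>I. z i) - (\<Sum>j\<in>#J. z j) \<in> \<int>"
    and I_less: "sum g I < real (size J) + 1" and I_ge: "0 \<le> sum g I"
    if IJ: "I \<subseteq> {1..n-1}" "set_mset J \<subseteq> {1..n}" "card I = size J + 1" for I J
  proof -
    have I: "I \<subseteq> {1..n}" "finite I"
      using IJ(1) by (force, auto intro: finite_subset)
    \<comment> \<open>The part common to all \<open>z i\<close> is counted
      \<open>card I - size J = 1\<close> times, which cancels \<open>F\<close> on \<open>I\<close>
      and at \<open>n\<close> and leaves its sum over the complement of \<open>I\<close>.\<close>
    let ?c = "g n + F n - sum F {1..n}"
    have "(\<Sum>i\<in>I. z i) = (\<Sum>i\<in>I. g i + F i + ?c)"
      using I z by (intro sum.cong) auto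
    also have "\<dots> = sum g I + sum F I + real (card I) * ?c"
      by (simp add: sum.distrib)
    finally have "(\<Sum>i\<in>I. z i) = sum g I + sum F I + real (card I) * ?c" .
    moreover have "(\<Sum>j\<in>#J. z j) = (\<Sum>j\<in>#J. g j + F j) + real (size J) * ?c"
      using IJ(2) by (induction J) (auto simp: z algebra_simps)
    moreover have "sum F {1..n} = sum F I + sum F ({1..n-1} - I) + F n"
    proof -
      have "{1..n} = insert n {1..n-1}" "n \<notin> {1..n-1}"
        using n by auto
      then have "sum F {1..n} = sum F {1..n-1} + F n"
        by simp
      then show ?thesis
        using sum.subset_diff[OF IJ(1), of F] by simp
    qed
    ultimately show "(\<Sum>i\<in>I. z i) - (\<Sum>j\<in>#J. z j) =
        sum g I - (\<Sum>j\<in>#J. g j + F j) + g n - sum F ({1..n-1} - I)"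
      by (simp add: IJ(3) algebra_simps)
    have "(\<Sum>j\<in>#J. z j) \<in> \<int>"
      using IJ(2) zZ by (induction J) auto
    then show "(\<Sum>i\<in>I. z i) - (\<Sum>j\<in>#J. z j) \<in> \<int>"
      using I zZ by (intro Ints_diff Ints_sum) auto
    have "I \<noteq> {}"
      using IJ(3) by auto
    then have "sum g I < (\<Sum>i\<in>I. 1)"
      using I g by (intro sum_strict_mono) auto
    then show "sum g I < real (size J) + 1"
      by (simp add: IJ(3))
    show "0 \<le> sum g I"
      using I g by (intro sum_nonneg) auto
  qed
  have J_bounds: "0 \<le> (\<Sum>j\<in>#J. g j + F j)"
    "(\<Sum>j\<in>#J. g j + F j) \<le> real (size J) + (\<Sum>j\<in>#J. real (r j))"
    if "set_mset J \<subseteq> {1..n}" for J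
    using that F g by (induction J) (auto, force+)
  have D_bounds: "0 \<le> sum F ({1..n-1} - I)" "sum F ({1..n-1} - I) \<le> (\<Sum>i\<in>{1..n-1} - I. real (r i))" for I
    using F by (auto intro!: sum_nonneg sum_mono) force+
  have "- real (size J) - (\<Sum>i\<in>{1..n-1} - I. real (r i)) - (\<Sum>j\<in>#J. real (r j)) + 1
        \<le> (\<Sum>i\<in>I. z i) - (\<Sum>j\<in>#J. z j) \<and>
      (\<Sum>i\<in>I. z i) - (\<Sum>j\<in>#J. z j) \<le> real (size J) + 1"
    if IJ: "I \<subseteq> {1..n-1}" "set_mset J \<subseteq> {1..n-1}" "card I = size J + 1" "I \<inter> set_mset J = {}" for I J
  proof -
    have J: "set_mset J \<subseteq> {1..n}"
      using IJ(2) by force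
    \<comment> \<open>The constant 1 in the lower bound needs one strict inequality
      \<open>F i < r i\<close> outside \<open>I\<close>. If \<open>J\<close> is empty then
      \<open>I\<close> is a singleton and \<open>n - 1\<close> is at least 2; otherwise an element
      of \<open>J\<close> lies outside \<open>I\<close>.\<close>
    have "{1..n-1} - I \<noteq> {}"
    proof (cases "J = {#}")
      case True
      then have "card ({1..n-1} - I) = n - 2"
        using IJ(1,3) by (subst card_Diff_subset) (auto intro: finite_subset)
      then have "card ({1..n-1} - I) \<noteq> 0"
        using n by linarith
      then show ?thesis
        by (metis card.empty)
    next
      case False
      then show ?thesis
        using IJ by (auto simp: multiset_nonemptyE)
    qed
    then have "sum F ({1..n-1} - I) < (\<Sum>i\<in>{1..n-1} - I. real (r i))"
      using F by (intro sum_strict_mono) force+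
    then have "- real (size J) - (\<Sum>i\<in>{1..n-1} - I. real (r i)) - (\<Sum>j\<in>#J. real (r j)) + 1
        < (\<Sum>i\<in>I. z i) - (\<Sum>j\<in>#J. z j) + 1"
      unfolding val[OF IJ(1) J IJ(3)]
      using I_ge[OF IJ(1) J IJ(3)] J_bounds(2)[OF J] g[OF nn] by linarith
    moreover have "(\<Sum>i\<in>I. z i) - (\<Sum>j\<in>#J. z j) < real (size J) + 1 + 1"
      unfolding val[OF IJ(1) J IJ(3)]
      using I_less[OF IJ(1) J IJ(3)] J_bounds(1)[OF J] g[OF nn] D_bounds(1)[of I] by linarith
    moreover have "(\<Sum>j\<in>#J. real (r j)) \<in> \<int>"
      by (induction J) auto
    ultimately show ?thesis
      using integral[OF IJ(1) J IJ(3)] by (intro conjI Ints_le_of_less_add_1) (auto intro!: Ints_sum)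
  qed
  moreover have "- real (size J) - (\<Sum>i\<in>{1..n-1} - I. real (r i)) - (\<Sum>j\<in>#J. real (r j)) + 2
        \<le> (\<Sum>i\<in>I. z i) - (\<Sum>j\<in>#J. z j) \<and>
      (\<Sum>i\<in>I. z i) - (\<Sum>j\<in>#J. z j) \<le> real (size J)"
    if IJ: "I \<subseteq> {1..n-1}" "set_mset J \<subseteq> {1..n}" "card I = size J + 1" "n \<in># J" for I J
  proof -
    \<comment> \<open>One copy of \<open>n\<close> in \<open>J\<close> cancels the free
      \<open>g n\<close> and leaves \<open>- F n\<close>, with \<open>F n < r n\<close> strictly.
      This improves both bounds by one over the case without \<open>n\<close>.\<close>
    obtain J' where J': "J = add_mset n J'"
      using IJ(4) by (blast dest: multi_member_split)
    then have J: "set_mset J' \<subseteq> {1..n}"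
      using IJ(2) by simp
    have "- real (size J) - (\<Sum>i\<in>{1..n-1} - I. real (r i)) - (\<Sum>j\<in>#J. real (r j)) + 2
        < (\<Sum>i\<in>I. z i) - (\<Sum>j\<in>#J. z j) + 1"
      unfolding val[OF IJ(1,2,3)]
      using I_ge[OF IJ(1,2,3)] J_bounds(2)[OF J] F[OF nn] D_bounds(2)[of I] by (simp add: J')
    moreover have "(\<Sum>i\<in>I. z i) - (\<Sum>j\<in>#J. z j) < real (size J) + 1"
      unfolding val[OF IJ(1,2,3)]
      using I_less[OF IJ(1,2,3)] J_bounds(1)[OF J] F[OF nn] D_bounds(1)[of I] by (simp add: J')
    moreover have "(\<Sum>j\<in>#J. real (r j)) \<in> \<int>"
      by (induction J) auto
    ultimately show ?thesis
      using integral[OF IJ(1,2,3)] by (intro conjI Ints_le_of_less_add_1) (auto intro!: Ints_sum)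
  qed
  ultimately show ?thesis
    using differences int unfolding multipartite_polytope_def integer_points_def PiE_def by blast
qed

subsection \<open>Edge rings of complete multipartite graphs\<close>

text \<open>The last two assumptions make every form below define a facet. For two parts the part
  forms are negatives of each other. For three parts with \<open>V i = {v}\<close>, setting the
  coordinate at \<open>v\<close> to 0 forces the other two part sums to agree, so this face is too
  small.\<close>

locale complete_multipartite =
  fixes n :: nat and V :: "nat \<Rightarrow> 'v::finite set"
  assumes disjoint: "disjoint_family_on V {1..n}"
    and vertices: "(\<Union>i\<in>{1..n}. V i) = UNIV"
    and nonempty: "\<And>i. i \<in> {1..n} \<Longrightarrow> V i \<noteq> {}"
    and n_ge: "3 \<le> n"
    and tripartite: "\<And>i. n = 3 \<Longrightarrow> i \<in> {1..n} \<Longrightarrow> 2 \<le> card (V i)"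
begin

definition part_form :: "nat \<Rightarrow> real ^ 'v" where
  "part_form i = (\<chi> v. if v \<in> V i then - 1 / 2 else 1 / 2)"

definition forms :: "(real ^ 'v) set" where
  "forms = range (\<lambda>v. axis v 1) \<union> part_form ` {1..n}"

definition even_lattice :: "(int ^ 'v) set" where
  "even_lattice = {u. even (\<Sum>v\<in>UNIV. u $ v)}"

definition part_of :: "'v \<Rightarrow> nat" where
  "part_of v = (THE i. i \<in> {1..n} \<and> v \<in> V i)"

lemma part_unique:
  assumes "i \<in> {1..n}" "j \<in> {1..n}" "v \<in> V i" "v \<in> V j"
  shows "i = j"
  using disjoint_family_onD[OF disjoint assms(1,2)] assms(3,4) by blast

lemma part_of_eq: "i \<in> {1..n} \<Longrightarrow> v \<in> V i \<Longrightarrow> part_of v = i"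
  unfolding part_of_def using part_unique by blast

lemma ex_part: "\<exists>i\<in>{1..n}. v \<in> V i"
  using vertices by blast

lemma sum_parts: "sum f UNIV = (\<Sum>i\<in>{1..n}. sum f (V i))"
proof -
  have "sum f (\<Union>i\<in>{1..n}. V i) = (\<Sum>i\<in>{1..n}. sum f (V i))"
    using disjoint by (intro sum.UNION_disjoint) (auto simp: disjoint_family_on_def)
  then show ?thesis
    by (simp only: vertices)
qed

lemma inner_axis_one: "axis v 1 \<bullet> (x :: real ^ 'v) = x $ v"
  by (simp add: inner_axis')

lemma inner_part_form: "part_form i \<bullet> x = (\<Sum>v\<in>UNIV. x $ v) / 2 - (\<Sum>v\<in>V i. x $ v)"
proof -
  have "part_form i \<bullet> x = (\<Sum>v\<in>UNIV. x $ v / 2 - (if v \<in> V i then x $ v else 0))"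
    unfolding inner_vec_def by (intro sum.cong) (auto simp: part_form_def)
  then show ?thesis
    by (simp add: sum_subtractf sum_divide_distrib sum.If_cases)
qed

lemma forms_cases:
  assumes "w \<in> forms"
  obtains v where "w = axis v 1" | i where "i \<in> {1..n}" "w = part_form i"
  using assms by (auto simp: forms_def)

lemma finite_forms: "finite forms"
  by (simp add: forms_def)

lemma real_vec_axis: "real_vec (axis v c) = axis v (of_int c)"
  by (simp add: real_vec_def axis_def vec_eq_iff)

lemma sum_real_vec: "(\<Sum>v\<in>A. real_vec u $ v) = of_int (\<Sum>v\<in>A. u $ v)"
  by (simp add: real_vec_def)

section \<open>Edges as generators of the cone\<close>

lemma inner_edge:
  assumes "i \<in> {1..n}" "j \<in> {1..n}" "i \<noteq> j" "a \<in> V i" "b \<in> V j"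
  shows "axis v 1 \<bullet> (axis a 1 + axis b 1 :: real ^ 'v) = (if v = a \<or> v = b then 1 else 0)"
    and "k \<in> {1..n} \<Longrightarrow> part_form k \<bullet> (axis a 1 + axis b 1) = (if k = i \<or> k = j then 0 else 1)"
proof -
  have "a \<noteq> b"
    using assms part_unique by blast
  then show "axis v 1 \<bullet> (axis a 1 + axis b 1 :: real ^ 'v) = (if v = a \<or> v = b then 1 else 0)"
    by (subst inner_axis_one) (auto simp: axis_def)
  assume "k \<in> {1..n}"
  then have "(a \<in> V k) = (k = i)" "(b \<in> V k) = (k = j)"
    using assms part_unique by blast+
  then show "part_form k \<bullet> (axis a 1 + axis b 1) = (if k = i \<or> k = j then 0 else 1)"
    using assms(3) by (simp add: inner_add_right inner_axis part_form_def)
qed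

lemma inner_edge_form:
  assumes "i \<in> {1..n}" "j \<in> {1..n}" "i \<noteq> j" "a \<in> V i" "b \<in> V j" "w \<in> forms"
  shows "w \<bullet> (axis a 1 + axis b 1) \<in> {0, 1}"
  using assms(6) by (cases rule: forms_cases) (auto simp: inner_edge[OF assms(1-5)])

text \<open>Take \<open>V i\<close> and \<open>V j\<close> of largest weight under \<open>x\<close>,
  and \<open>a\<close>, \<open>b\<close> in them with positive coordinates. The forms that do not
  vanish on this edge are the coordinates at \<open>a\<close>, \<open>b\<close> and the part forms
  of the other parts, and none of these vanishes at \<open>x\<close>.\<close>

lemma ex_positive_edge:
  fixes x :: "real ^ 'v"
  assumes "x \<noteq> 0" and x: "\<And>w. w \<in> forms \<Longrightarrow> 0 \<le> w \<bullet> x"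
  obtains i j a b where "i \<in> {1..n}" "j \<in> {1..n}" "i \<noteq> j" "a \<in> V i" "b \<in> V j"
    "\<And>w. w \<in> forms \<Longrightarrow> w \<bullet> (axis a 1 + axis b 1) \<noteq> 0 \<Longrightarrow> 0 < w \<bullet> x"
proof -
  define p where "p i = (\<Sum>v\<in>V i. x $ v)" for i
  define S where "S = (\<Sum>v\<in>UNIV. x $ v)"
  have x0: "0 \<le> x $ v" for v
    using x[of "axis v 1"] by (simp add: forms_def inner_axis_one)
  have half: "p i \<le> S / 2" if "i \<in> {1..n}" for i
    using x[of "part_form i"] that by (simp add: forms_def inner_part_form p_def S_def)
  have p0: "0 \<le> p i" for i
    using x0 by (simp add: p_def sum_nonneg)
  have S_eq: "S = sum p {1..n}"
    by (simp add: S_def p_def sum_parts)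
  have "S \<noteq> 0"
    using \<open>x \<noteq> 0\<close> x0 by (simp add: S_def sum_nonneg_eq_0_iff vec_eq_iff)
  then have S: "0 < S"
    using x0 by (simp add: S_def less_le sum_nonneg)
  have ex_max: "\<exists>i\<in>K. \<forall>k\<in>K. p k \<le> p i" if "finite K" "K \<noteq> {}" for K
  proof -
    have "Max (p ` K) \<in> p ` K"
      using that by (intro Max_in) auto
    then obtain i where "i \<in> K" "Max (p ` K) = p i"
      by blast
    then show ?thesis
      using that Max_ge[of "p ` K"] by (intro bexI[of _ i]) auto
  qed
  obtain i where i: "i \<in> {1..n}" "\<And>k. k \<in> {1..n} \<Longrightarrow> p k \<le> p i"
    using ex_max[of "{1..n}"] n_ge by auto
  have "{1..n} - {i} \<noteq> {}"
  proof
    assume "{1..n} - {i} = {}"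
    then have "card {1..n} \<le> card {i}"
      by (intro card_mono) auto
    then show False
      using n_ge by simp
  qed
  then obtain j where "j \<in> {1..n} - {i}" "\<forall>k\<in>{1..n} - {i}. p k \<le> p j"
    using ex_max[of "{1..n} - {i}"] by blast
  then have j: "j \<in> {1..n}" "j \<noteq> i" "\<And>k. k \<in> {1..n} \<Longrightarrow> k \<noteq> i \<Longrightarrow> p k \<le> p j"
    by auto
  \<comment> \<open>Otherwise all the weight would lie in \<open>V i\<close>, against
    \<open>p i \<le> S / 2\<close>.\<close>
  have pj: "0 < p j"
  proof (rule ccontr)
    assume "\<not> 0 < p j"
    then have "sum p ({1..n} - {i}) = 0"
      using j p0 by (intro sum.neutral) (force intro: antisym)
    then have "S = p i"
      using i(1) by (simp add: S_eq sum.remove)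
    then show False
      using half[OF i(1)] S by simp
  qed
  have "0 < p i"
    using pj i(2)[OF j(1)] by simp
  obtain a where a: "a \<in> V i" "0 < x $ a"
    using \<open>0 < p i\<close> sum_nonpos[of "V i" "\<lambda>v. x $ v"] unfolding p_def by (meson not_le)
  obtain b where b: "b \<in> V j" "0 < x $ b"
    using pj sum_nonpos[of "V j" "\<lambda>v. x $ v"] unfolding p_def by (meson not_le)
  \<comment> \<open>If a third part carried half the weight, so would the two heavier ones, and the
    total would exceed \<open>S\<close>.\<close>
  have slack: "p k < S / 2" if k: "k \<in> {1..n}" "k \<noteq> i" "k \<noteq> j" for k
  proof (rule ccontr)
    assume "\<not> p k < S / 2"
    then have "S / 2 \<le> p k"
      by simp
    moreover have "sum p {i, j, k} \<le> S"
      unfolding S_eq using i j k p0 by (intro sum_mono2) auto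
    then have "p i + p j + p k \<le> S"
      using i j k by simp
    ultimately show False
      using i(2)[OF k(1)] j(3)[OF k(1,2)] S by linarith
  qed
  have "0 < w \<bullet> x" if w: "w \<in> forms" "w \<bullet> (axis a 1 + axis b 1) \<noteq> 0" for w
    using w(1)
  proof (cases rule: forms_cases)
    case (1 v)
    then show ?thesis
      using w(2) a b inner_edge(1)[OF i(1) j(1) j(2)[symmetric] a(1) b(1), of v]
      by (auto simp: inner_axis_one split: if_splits)
  next
    case (2 k)
    then show ?thesis
      using w(2) slack[of k] inner_edge(2)[OF i(1) j(1) j(2)[symmetric] a(1) b(1), of k]
      by (auto simp: inner_part_form p_def S_def split: if_splits)
  qed
  then show ?thesis
    using that[OF i(1) j(1) j(2)[symmetric] a(1) b(1)] by blast
qed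

text \<open>
  With \<open>G = \<int>\<close> this gives generators of the monoid of lattice points of the cone (normality),
  with \<open>G = UNIV\<close> generators of the cone itself. Each step removes the largest admissible multiple
  of an edge between the two heaviest parts, which makes one more form vanish.
\<close>

lemma cone_induct:
  fixes x :: "real ^ 'v"
  assumes x: "\<And>w. w \<in> forms \<Longrightarrow> 0 \<le> w \<bullet> x" and G: "\<And>w. w \<in> forms \<Longrightarrow> w \<bullet> x \<in> G"
    and G_diff: "\<And>s t. s \<in> G \<Longrightarrow> t \<in> G \<Longrightarrow> s - t \<in> G"
    and zero: "P 0"
    and add: "\<And>y t a b i j. P y \<Longrightarrow> t \<in> G \<Longrightarrow> 0 \<le> t \<Longrightarrow> i \<in> {1..n} \<Longrightarrow> j \<in> {1..n} \<Longrightarrow> i \<noteq> j \<Longrightarrow>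
      a \<in> V i \<Longrightarrow> b \<in> V j \<Longrightarrow> P (y + t *\<^sub>R (axis a 1 + axis b 1))"
  shows "P x"
  using x G
proof (induction "card {w \<in> forms. w \<bullet> x \<noteq> 0}" arbitrary: x rule: less_induct)
  case less
  show ?case
  proof (cases "x = 0")
    case True
    then show ?thesis
      using zero by simp
  next
    case False
    then obtain i j a b where edge: "i \<in> {1..n}" "j \<in> {1..n}" "i \<noteq> j" "a \<in> V i" "b \<in> V j"
      and pos: "\<And>w. w \<in> forms \<Longrightarrow> w \<bullet> (axis a 1 + axis b 1) \<noteq> 0 \<Longrightarrow> 0 < w \<bullet> x"
      using ex_positive_edge[OF False less.prems(1)] by metis
    define d :: "real ^ 'v" where "d = axis a 1 + axis b 1"
    have d01: "w \<bullet> d = 0 \<or> w \<bullet> d = 1" if "w \<in> forms" for w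
      using inner_edge_form[OF edge that] by (simp add: d_def)
    let ?W = "{w \<in> forms. w \<bullet> d = 1}"
    have "axis a 1 \<in> ?W"
      using inner_edge(1)[OF edge, of a] by (simp add: forms_def d_def)
    then have ne: "(\<lambda>w. w \<bullet> x) ` ?W \<noteq> {}" and fin: "finite ((\<lambda>w. w \<bullet> x) ` ?W)"
      using finite_forms by auto
    \<comment> \<open>\<open>t\<close> is the value of some form at \<open>x\<close> and hence lies
      in \<open>G\<close>; as the forms are 0 or 1 on the edge, all values at the remainder stay in
      \<open>G\<close> too.\<close>
    define t where "t = Min ((\<lambda>w. w \<bullet> x) ` ?W)"
    have "t \<in> (\<lambda>w. w \<bullet> x) ` ?W"
      unfolding t_def by (rule Min_in[OF fin ne])
    then obtain w0 where w0: "w0 \<in> forms" "w0 \<bullet> d = 1" "t = w0 \<bullet> x"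
      by blast
    have t_le: "t \<le> w \<bullet> x" if "w \<in> forms" "w \<bullet> d = 1" for w
      unfolding t_def using fin that by (intro Min_le) auto
    have t: "0 < t" "t \<in> G"
      using pos[OF w0(1)] w0 less.prems(2) by (simp_all add: d_def)
    define y where "y = x - t *\<^sub>R d"
    have wy: "w \<bullet> y = w \<bullet> x - t * (w \<bullet> d)" for w
      by (simp add: y_def inner_diff_right)
    have "{w \<in> forms. w \<bullet> y \<noteq> 0} \<subset> {w \<in> forms. w \<bullet> x \<noteq> 0}"
    proof (intro psubsetI subsetI)
      fix w assume w: "w \<in> {w \<in> forms. w \<bullet> y \<noteq> 0}"
      then show "w \<in> {w \<in> forms. w \<bullet> x \<noteq> 0}"
        using d01[of w] pos[of w] by (auto simp: wy d_def)
    next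
      show "{w \<in> forms. w \<bullet> y \<noteq> 0} \<noteq> {w \<in> forms. w \<bullet> x \<noteq> 0}"
        using w0 t wy[of w0] by force
    qed
    then have "card {w \<in> forms. w \<bullet> y \<noteq> 0} < card {w \<in> forms. w \<bullet> x \<noteq> 0}"
      using finite_forms by (intro psubset_card_mono) auto
    moreover have "0 \<le> w \<bullet> y" if "w \<in> forms" for w
      using d01[OF that] t_le[OF that] less.prems(1)[OF that] by (auto simp: wy)
    moreover have "w \<bullet> y \<in> G" if "w \<in> forms" for w
      using d01[OF that] less.prems(2)[OF that] t(2) by (auto simp: wy intro: G_diff)
    ultimately have "P y"
      by (rule less.hyps)
    then have "P (y + t *\<^sub>R (axis a 1 + axis b 1))"
      using t edge by (intro add) auto
    then show ?thesis
      by (simp add: y_def d_def)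
  qed
qed

section \<open>Lattice points in the interior and on the facets\<close>

lemma lattice_integral:
  assumes "w \<in> forms" "u \<in> even_lattice"
  shows "w \<bullet> real_vec u \<in> \<int>"
  using assms(1)
proof (cases rule: forms_cases)
  case (1 v)
  then show ?thesis
    by (simp add: inner_axis_one real_vec_def)
next
  case (2 i)
  obtain k where "(\<Sum>v\<in>UNIV. u $ v) = 2 * k"
    using assms(2) by (auto simp: even_lattice_def elim: evenE)
  then have "w \<bullet> real_vec u = of_int (k - (\<Sum>v\<in>V i. u $ v))"
    by (simp add: 2 inner_part_form sum_real_vec)
  then show ?thesis
    by (metis Ints_of_int)
qed

lemma zero_even_lattice: "0 \<in> even_lattice"
  by (simp add: even_lattice_def)

lemma diff_even_lattice: "u \<in> even_lattice \<Longrightarrow> v \<in> even_lattice \<Longrightarrow> u - v \<in> even_lattice"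
  by (simp add: even_lattice_def sum_subtractf)

lemma edge_in_even_lattice: "axis a 1 + axis b 1 \<in> even_lattice"
  by (simp add: even_lattice_def sum.distrib axis_def)

text \<open>This gives primitivity: a coordinate form takes the value 1 on any edge at its vertex,
  and a part form on an edge between two other parts, which exist since \<open>n\<close> is at least
  3.\<close>

lemma ex_edge_form_1:
  assumes "w \<in> forms"
  obtains i j a b where "i \<in> {1..n}" "j \<in> {1..n}" "i \<noteq> j" "a \<in> V i" "b \<in> V j"
    "w \<bullet> (axis a 1 + axis b 1) = 1"
proof -
  have other: "\<exists>j\<in>{1..n}. j \<notin> {i, k}" for i k
  proof (rule ccontr)
    assume "\<not> (\<exists>j\<in>{1..n}. j \<notin> {i, k})"
    then have "card {1..n} \<le> card {i, k}"
      by (intro card_mono) auto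
    also have "\<dots> \<le> 2"
      by (simp add: card_insert_if)
    finally show False
      using n_ge by simp
  qed
  show ?thesis
    using assms
  proof (cases rule: forms_cases)
    case (1 v)
    obtain i where i: "i \<in> {1..n}" "v \<in> V i"
      using ex_part by blast
    obtain j where j: "j \<in> {1..n}" "j \<noteq> i"
      using other[of i i] by auto
    obtain b where "b \<in> V j"
      using nonempty[OF j(1)] by blast
    then show ?thesis
      using that[of i j v b] i j inner_edge(1)[of i j v b v] 1 by auto
  next
    case (2 k)
    obtain i where i: "i \<in> {1..n}" "i \<noteq> k"
      using other[of k k] by auto
    obtain j where j: "j \<in> {1..n}" "j \<noteq> i" "j \<noteq> k"
      using other[of i k] by auto
    obtain a b where "a \<in> V i" "b \<in> V j"
      using nonempty[OF i(1)] nonempty[OF j(1)] by blast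
    then show ?thesis
      using that[of i j a b] i j inner_edge(2)[of i j a b k] 2 by auto
  qed
qed

lemma real_vec_edge: "real_vec (axis a 1 + axis b 1) = axis a 1 + axis b 1"
  by (simp add: real_vec_add real_vec_axis)

lemma span_even_lattice: "span (real_vec ` even_lattice) = UNIV"
proof -
  have "axis v 1 \<in> span (real_vec ` even_lattice)" for v
  proof -
    have "real_vec (axis v 1 + axis v 1) \<in> span (real_vec ` even_lattice)"
      by (intro span_base imageI edge_in_even_lattice)
    then have "(1 / 2) *\<^sub>R (axis v 1 + axis v 1 :: real ^ 'v) \<in> span (real_vec ` even_lattice)"
      unfolding real_vec_edge by (rule span_scale)
    then show ?thesis
      by (simp add: scaleR_add_right flip: scaleR_left_distrib)
  qed
  then have "Basis \<subseteq> span (real_vec ` even_lattice)"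
    by (auto simp: Basis_vec_def)
  then have "span Basis \<subseteq> span (real_vec ` even_lattice)"
    by (intro span_minimal) auto
  then show ?thesis
    by auto
qed

text \<open>Part \<open>i\<close> receives weight proportional to \<open>t i\<close>, spread evenly
  over \<open>W i\<close>. The factorial makes the division by \<open>card (W i)\<close> exact, and
  the factor 2 in \<open>c\<close> puts the point into the lattice.\<close>

lemma ex_weighted_point:
  fixes W :: "nat \<Rightarrow> 'v set" and t :: "nat \<Rightarrow> nat"
  assumes "\<And>i. i \<in> {1..n} \<Longrightarrow> W i \<subseteq> V i" "\<And>i. i \<in> {1..n} \<Longrightarrow> W i = {} \<Longrightarrow> t i = 0"
  obtains u where "u \<in> even_lattice" "\<And>i v. i \<in> {1..n} \<Longrightarrow> v \<in> W i \<Longrightarrow> 1 \<le> t i \<Longrightarrow> 1 \<le> real_vec u $ v"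
    "\<And>i v. i \<in> {1..n} \<Longrightarrow> v \<in> V i - W i \<Longrightarrow> real_vec u $ v = 0"
    "\<And>i. i \<in> {1..n} \<Longrightarrow> part_form i \<bullet> real_vec u = (real (sum t {1..n}) - 2 * real (t i)) * fact CARD('v)"
proof -
  define c where "c i = 2 * t i * (fact CARD('v) div card (W i))" for i
  define u :: "int ^ 'v" where "u = (\<chi> v. if v \<in> W (part_of v) then int (c (part_of v)) else 0)"
  have u: "u $ v = (if v \<in> W i then int (c i) else 0)" if "i \<in> {1..n}" "v \<in> V i" for i v
    using part_of_eq[OF that] by (simp add: u_def)
  have dvd: "card (W i) dvd fact CARD('v)" if "W i \<noteq> {}" for i
    using that by (intro dvd_fact) (auto simp: Suc_le_eq card_gt_0_iff card_mono)
  have part_sum: "(\<Sum>v\<in>V i. u $ v) = 2 * int (t i) * fact CARD('v)" if i: "i \<in> {1..n}" for i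
  proof -
    have "(\<Sum>v\<in>V i. u $ v) = (\<Sum>v\<in>V i. if v \<in> W i then int (c i) else 0)"
      using u[OF i] by (intro sum.cong) auto
    also have "\<dots> = int (card (W i) * c i)"
      using assms(1)[OF i] by (simp add: sum.If_cases Int_absorb1)
    also have "card (W i) * c i = 2 * t i * fact CARD('v)"
    proof (cases "W i = {}")
      case True
      then show ?thesis
        using assms(2)[OF i] by simp
    next
      case False
      then have "card (W i) * (fact CARD('v) div card (W i)) = fact CARD('v)"
        using dvd by (intro dvd_mult_div_cancel) auto
      then show ?thesis
        unfolding c_def by (metis mult.assoc mult.commute)
    qed
    finally show ?thesis
      by simp
  qed
  have total: "(\<Sum>v\<in>UNIV. u $ v) = 2 * int (sum t {1..n}) * fact CARD('v)"
    by (simp add: sum_parts[of "\<lambda>v. u $ v"] part_sum sum_distrib_left sum_distrib_right)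
  show ?thesis
  proof (rule that[of u])
    show "u \<in> even_lattice"
      by (simp add: even_lattice_def total)
    show "1 \<le> real_vec u $ v" if "i \<in> {1..n}" "v \<in> W i" "1 \<le> t i" for i v
    proof -
      have "W i \<noteq> {}"
        using that(2) by auto
      then have "fact CARD('v) div card (W i) \<noteq> 0"
        using dvd[of i] by (metis dvd_div_eq_0_iff fact_nonzero)
      then have "1 \<le> c i"
        using that(3) by (simp add: c_def)
      then show ?thesis
        using u[of i v] assms(1)[OF that(1)] that(1,2) by (auto simp: real_vec_def)
    qed
    show "real_vec u $ v = 0" if "i \<in> {1..n}" "v \<in> V i - W i" for i v
      using u[of i v] that by (simp add: real_vec_def)
    show "part_form i \<bullet> real_vec u = (real (sum t {1..n}) - 2 * real (t i)) * fact CARD('v)"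
      if "i \<in> {1..n}" for i
      by (simp only: inner_part_form sum_real_vec total part_sum[OF that]) (simp add: algebra_simps)
  qed
qed

lemma fact_multiple_ge_1: "1 \<le> k \<Longrightarrow> 1 \<le> k * fact m" for k :: real
  using mult_mono[of 1 k 1 "fact m"] fact_ge_1[of m, where 'a = real] by simp

lemma interior_lattice_point: "\<exists>u\<in>even_lattice. \<forall>w\<in>forms. 1 \<le> w \<bullet> real_vec u"
proof -
  obtain u where u: "u \<in> even_lattice" "\<And>i v. i \<in> {1..n} \<Longrightarrow> v \<in> V i \<Longrightarrow> 1 \<le> real_vec u $ v"
    "\<And>i. i \<in> {1..n} \<Longrightarrow> part_form i \<bullet> real_vec u = (real n - 2) * fact CARD('v)"
    by (rule ex_weighted_point[of V "\<lambda>_. 1"]) (use nonempty in auto)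
  have "1 \<le> w \<bullet> real_vec u" if "w \<in> forms" for w
    using that
  proof (cases rule: forms_cases)
    case (1 v)
    then show ?thesis
      using u(2) ex_part[of v] by (auto simp: inner_axis_one)
  next
    case (2 i)
    then show ?thesis
      using u(3) n_ge by (simp add: fact_multiple_ge_1)
  qed
  then show ?thesis
    using u(1) by blast
qed

lemma facet_lattice_point:
  assumes "w \<in> forms"
  shows "\<exists>u\<in>even_lattice. w \<bullet> real_vec u = 0 \<and> (\<forall>w'\<in>forms - {w}. 1 \<le> w' \<bullet> real_vec u)"
  using assms
proof (cases rule: forms_cases)
  case (1 v)
  obtain i where i: "i \<in> {1..n}" "v \<in> V i"
    using ex_part by blast
  \<comment> \<open>Every part left nonempty by the removal of \<open>v\<close> gets weight 1. The
    total is at least 3: for \<open>n = 3\<close> the part of \<open>v\<close> has another vertex,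
    and for larger \<open>n\<close> the other parts suffice. So every part form is positive.\<close>
  define t :: "nat \<Rightarrow> nat" where "t j = of_bool (V j - {v} \<noteq> {})" for j
  obtain u where u: "u \<in> even_lattice"
    "\<And>j x. j \<in> {1..n} \<Longrightarrow> x \<in> V j - {v} \<Longrightarrow> 1 \<le> t j \<Longrightarrow> 1 \<le> real_vec u $ x"
    "\<And>j x. j \<in> {1..n} \<Longrightarrow> x \<in> V j - (V j - {v}) \<Longrightarrow> real_vec u $ x = 0"
    "\<And>j. j \<in> {1..n} \<Longrightarrow> part_form j \<bullet> real_vec u = (real (sum t {1..n}) - 2 * real (t j)) * fact CARD('v)"
    by (rule ex_weighted_point[of "\<lambda>j. V j - {v}" t]) (auto simp: t_def)
  have t_other: "t j = 1" if "j \<in> {1..n} - {i}" for j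
    using nonempty[of j] part_unique[of i j v] that i by (auto simp: t_def)
  have "sum t {1..n} = t i + (n - 1)"
    using i(1) t_other by (simp add: sum.remove)
  moreover have "t i = 1" if "n = 3"
  proof -
    have "V i \<noteq> {v}"
      using tripartite[OF that i(1)] by auto
    then show ?thesis
      using i(2) by (auto simp: t_def)
  qed
  ultimately have "3 \<le> sum t {1..n}"
    using n_ge by (cases "n = 3") auto
  moreover have "t j \<le> 1" for j
    by (simp add: t_def)
  ultimately have slack: "1 \<le> real (sum t {1..n}) - 2 * real (t j)" for j
    using of_nat_mono[of 3 "sum t {1..n}", where 'a = real] of_nat_mono[of "t j" 1, where 'a = real]
    by fastforce
  have "1 \<le> w' \<bullet> real_vec u" if w': "w' \<in> forms" "w' \<noteq> w" for w'
    using w'(1)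
  proof (cases rule: forms_cases)
    case v': (1 v')
    obtain j where j: "j \<in> {1..n}" "v' \<in> V j"
      using ex_part by blast
    moreover have "v' \<noteq> v"
      using w'(2) v' 1 by auto
    moreover from calculation have "t j = 1"
      by (auto simp: t_def)
    ultimately show ?thesis
      using u(2)[of j v'] v' by (simp add: inner_axis_one)
  next
    case (2 j)
    then show ?thesis
      using u(4) slack fact_multiple_ge_1 by simp
  qed
  moreover have "w \<bullet> real_vec u = 0"
    using u(3)[OF i(1)] i(2) 1 by (simp add: inner_axis_one)
  ultimately show ?thesis
    using u(1) by blast
next
  case (2 i)
  \<comment> \<open>Weight \<open>n - 1\<close> on part \<open>i\<close> balances the
    \<open>n - 1\<close> other parts of weight 1, so exactly the form of part \<open>i\<close>
    vanishes.\<close>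
  define t where "t j = (if j = i then n - 1 else 1)" for j
  obtain u where u: "u \<in> even_lattice"
    "\<And>j x. j \<in> {1..n} \<Longrightarrow> x \<in> V j \<Longrightarrow> 1 \<le> t j \<Longrightarrow> 1 \<le> real_vec u $ x"
    "\<And>j. j \<in> {1..n} \<Longrightarrow> part_form j \<bullet> real_vec u = (real (sum t {1..n}) - 2 * real (t j)) * fact CARD('v)"
    by (rule ex_weighted_point[of V t]) (use nonempty in auto)
  have "sum t {1..n} = t i + (\<Sum>j\<in>{1..n} - {i}. t j)"
    using 2(1) by (simp add: sum.remove)
  also have "(\<Sum>j\<in>{1..n} - {i}. t j) = n - 1"
    using 2(1) by (simp add: t_def)
  finally have total: "real (sum t {1..n}) = 2 * (real n - 1)"
    using n_ge by (simp add: t_def of_nat_diff)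
  have "1 \<le> w' \<bullet> real_vec u" if w': "w' \<in> forms" "w' \<noteq> w" for w'
    using w'(1)
  proof (cases rule: forms_cases)
    case (1 v)
    obtain j where j: "j \<in> {1..n}" "v \<in> V j"
      using ex_part by blast
    moreover have "1 \<le> t j"
      using n_ge by (auto simp: t_def)
    ultimately show ?thesis
      using u(2)[of j v] 1 by (simp add: inner_axis_one)
  next
    case j: (2 j)
    then have "t j = 1"
      using w'(2) 2 by (auto simp: t_def)
    then show ?thesis
      using u(3)[of j] j n_ge total by (simp add: fact_multiple_ge_1 del: of_nat_sum)
  qed
  moreover have "w \<bullet> real_vec u = 0"
    using u(3)[OF 2(1)] total 2(2) n_ge by (simp add: t_def of_nat_diff del: of_nat_sum)
  ultimately show ?thesis
    using u(1) by blast
qed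

section \<open>The edge ring as a normal monoid algebra\<close>

definition cone_monoid :: "(int ^ 'v) set" where
  "cone_monoid = {u \<in> even_lattice. \<forall>w\<in>forms. 0 \<le> w \<bullet> real_vec u}"

lemma edge_in_cone_monoid:
  assumes "i \<in> {1..n}" "j \<in> {1..n}" "i \<noteq> j" "a \<in> V i" "b \<in> V j"
  shows "axis a 1 + axis b 1 \<in> cone_monoid"
  using inner_edge_form[OF assms]
  by (force simp: cone_monoid_def edge_in_even_lattice real_vec_edge)

lemma multipartite_edges_iff:
  "{a, b} \<in> multipartite_edges n V \<longleftrightarrow> (\<exists>i\<in>{1..n}. \<exists>j\<in>{1..n}. i \<noteq> j \<and> a \<in> V i \<and> b \<in> V j)"
proof
  assume "{a, b} \<in> multipartite_edges n V"
  then obtain a' b' i j where "{a, b} = {a', b'}" "a' \<in> V i" "b' \<in> V j" "1 \<le> i" "i < j" "j \<le> n"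
    by (auto simp: multipartite_edges_def)
  moreover from this have "i \<in> {1..n}" "j \<in> {1..n}" "i \<noteq> j"
    by auto
  ultimately show "\<exists>i\<in>{1..n}. \<exists>j\<in>{1..n}. i \<noteq> j \<and> a \<in> V i \<and> b \<in> V j"
    unfolding doubleton_eq_iff by metis
next
  assume "\<exists>i\<in>{1..n}. \<exists>j\<in>{1..n}. i \<noteq> j \<and> a \<in> V i \<and> b \<in> V j"
  then obtain i j where ij: "i \<in> {1..n}" "j \<in> {1..n}" "i \<noteq> j" "a \<in> V i" "b \<in> V j"
    by blast
  then consider "i < j" | "j < i"
    by linarith
  then show "{a, b} \<in> multipartite_edges n V"
  proof cases
    case 1
    then show ?thesis
      unfolding multipartite_edges_def using ij
      by (intro CollectI exI[of _ a] exI[of _ b] exI[of _ i] exI[of _ j]) auto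
  next
    case 2
    then show ?thesis
      unfolding multipartite_edges_def using ij
      by (intro CollectI exI[of _ b] exI[of _ a] exI[of _ j] exI[of _ i]) auto
  qed
qed

text \<open>Normality is the point: by \<open>cone_induct\<close> over the integers, every lattice
  point of the cone is a sum of edges, so its monomial is a product of generators.\<close>

lemma edge_ring_eq:
  "edge_ring (multipartite_edges n V) = {f :: ('v, 'k::field) laurent. Poly_Mapping.keys f \<subseteq> cone_monoid}"
  unfolding edge_ring_def
proof (rule hull_unique)
  have var_times: "var a * var b = (lmonom (axis a 1 + axis b 1) :: ('v, 'k) laurent)" for a b :: 'v
    by (simp add: var_def lmonom_def mult_single)
  show "{var i * var j | i j. {i, j} \<in> multipartite_edges n V}
      \<subseteq> {f :: ('v, 'k) laurent. Poly_Mapping.keys f \<subseteq> cone_monoid}"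
    using edge_in_cone_monoid by (auto simp: var_times multipartite_edges_iff lmonom_def)
  have add: "u + v \<in> cone_monoid" if "u \<in> cone_monoid" "v \<in> cone_monoid" for u v
    using that by (auto simp: cone_monoid_def even_lattice_def sum.distrib real_vec_add inner_add_right)
  show "subalgebra {f :: ('v, 'k) laurent. Poly_Mapping.keys f \<subseteq> cone_monoid}"
    unfolding subalgebra_def mem_Collect_eq
  proof (intro conjI allI ballI)
    fix f g :: "('v, 'k) laurent"
    assume fg: "f \<in> {f. Poly_Mapping.keys f \<subseteq> cone_monoid}" "g \<in> {f. Poly_Mapping.keys f \<subseteq> cone_monoid}"
    then show "Poly_Mapping.keys (f + g) \<subseteq> cone_monoid"
      using Poly_Mapping.keys_add[of f g] by blast
    show "Poly_Mapping.keys (f * g) \<subseteq> cone_monoid"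
      using fg keys_mult[of f g] add by blast
  qed (simp add: cone_monoid_def zero_even_lattice)
  fix A :: "('v, 'k) laurent set"
  assume gen: "{var i * var j | i j. {i, j} \<in> multipartite_edges n V} \<subseteq> A" and A: "subalgebra A"
  have const: "Poly_Mapping.single 0 c \<in> A" for c
    using A by (simp add: subalgebra_def)
  have times: "f * g \<in> A" if "f \<in> A" "g \<in> A" for f g
    using A that by (simp add: subalgebra_def)
  have monomial: "lmonom u \<in> A" if u: "u \<in> cone_monoid" for u
  proof -
    \<comment> \<open>The induction runs over real vectors, so the claim is stated for some integral
      preimage; injectivity of \<open>real_vec\<close> brings it back to \<open>u\<close>.\<close>
    have "\<exists>u'. real_vec u = real_vec u' \<and> lmonom u' \<in> A"
    proof (rule cone_induct[of "real_vec u" \<int>])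
      show "\<exists>u'. 0 = real_vec u' \<and> lmonom u' \<in> A"
        using const[of 1] by (intro exI[of _ 0]) (simp add: lmonom_def)
      fix y a b i j and t :: real
      assume y: "\<exists>u'. y = real_vec u' \<and> lmonom u' \<in> A" and t: "t \<in> \<int>" "0 \<le> t"
        and edge: "i \<in> {1..n}" "j \<in> {1..n}" "i \<noteq> j" "a \<in> V i" "b \<in> V j"
      obtain u' where u': "y = real_vec u'" "lmonom u' \<in> A"
        using y by blast
      obtain k where "t = of_int k"
        using t(1) by (auto elim: Ints_cases)
      then have k: "t = of_nat (nat k)"
        using t(2) by simp
      have "lmonom (axis a 1 + axis b 1) \<in> A"
        using gen edge multipartite_edges_iff by (fastforce simp: var_times)
      then have "lmonom (u' + int m *s (axis a 1 + axis b 1)) \<in> A" for m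
      proof (induction m)
        case (Suc m)
        then have "lmonom (u' + int m *s (axis a 1 + axis b 1)) * lmonom (axis a 1 + axis b 1) \<in> A"
          by (intro times) auto
        then show ?case
          by (simp add: lmonom_def mult_single vector_sadd_rdistrib ac_simps)
      qed (simp add: u')
      then show "\<exists>u'. y + t *\<^sub>R (axis a 1 + axis b 1) = real_vec u' \<and> lmonom u' \<in> A"
        by (intro exI[of _ "u' + int (nat k) *s (axis a 1 + axis b 1)"])
          (simp only: real_vec_add[of u'] real_vec_scale real_vec_edge u' k, simp)
    qed (use u lattice_integral in \<open>auto simp: cone_monoid_def\<close>)
    then show ?thesis
      by (metis inj_real_vec injD)
  qed
  show "{f. Poly_Mapping.keys f \<subseteq> cone_monoid} \<subseteq> A"
  proof
    fix f :: "('v, 'k) laurent" assume f: "f \<in> {f. Poly_Mapping.keys f \<subseteq> cone_monoid}"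
    show "f \<in> A"
    proof (rule poly_mapping_in_closed)
      fix u assume "u \<in> Poly_Mapping.keys f"
      then have "Poly_Mapping.single 0 (Poly_Mapping.lookup f u) * lmonom u \<in> A"
        using f monomial by (intro times const) auto
      then show "Poly_Mapping.single u (Poly_Mapping.lookup f u) \<in> A"
        by (simp add: lmonom_def mult_single)
    qed (use A const[of 0] in \<open>auto simp: subalgebra_def\<close>)
  qed
qed

text \<open>The same induction with arbitrary real coefficients writes any point satisfying the
  inequalities as a nonnegative combination of edges.\<close>

lemma exp_cone_edge_ring:
  "exp_cone (edge_ring (multipartite_edges n V) :: ('v, 'k::field) laurent set) = {x. \<forall>w\<in>forms. 0 \<le> w \<bullet> x}"
proof -
  let ?C = "conic hull (convex hull (real_vec ` cone_monoid))"
  have "exp_monoid (edge_ring (multipartite_edges n V) :: ('v, 'k) laurent set) = cone_monoid"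
    by (simp add: exp_monoid_def edge_ring_eq lmonom_def)
  then have "exp_cone (edge_ring (multipartite_edges n V) :: ('v, 'k) laurent set) = ?C"
    by (simp add: exp_cone_def)
  also have "?C = {x. \<forall>w\<in>forms. 0 \<le> w \<bullet> x}"
  proof
    show "?C \<subseteq> {x. \<forall>w\<in>forms. 0 \<le> w \<bullet> x}"
      by (intro hull_minimal) (auto simp: cone_monoid_def convex_def conic_def inner_add_right)
    have in_C: "x \<in> ?C" if "x \<in> real_vec ` cone_monoid" for x
      using that by (meson hull_inc)
    have add: "x + y \<in> ?C" if "x \<in> ?C" "y \<in> ?C" for x y
    proof -
      have "(1 / 2) *\<^sub>R x + (1 / 2) *\<^sub>R y \<in> ?C"
        using that by (intro convexD[OF convex_conic_hull[OF convex_convex_hull]]) auto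
      from conicD[OF conic_conic_hull this, of 2] show ?thesis
        by (simp add: scaleR_add_right)
    qed
    show "{x. \<forall>w\<in>forms. 0 \<le> w \<bullet> x} \<subseteq> ?C"
    proof
      fix x assume "x \<in> {x. \<forall>w\<in>forms. 0 \<le> w \<bullet> x}"
      then show "x \<in> ?C"
      proof (intro cone_induct[of x UNIV "\<lambda>x. x \<in> ?C"])
        show "0 \<in> ?C"
          by (intro in_C image_eqI[where x = 0]) (simp_all add: cone_monoid_def zero_even_lattice)
        fix y t a b i j
        assume y: "y \<in> ?C" and t: "0 \<le> (t :: real)"
          and edge: "i \<in> {1..n}" "j \<in> {1..n}" "i \<noteq> j" "a \<in> V i" "b \<in> V j"
        have "axis a 1 + axis b 1 \<in> ?C"
          using edge_in_cone_monoid[OF edge] by (intro in_C) (metis imageI real_vec_edge)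
        then show "y + t *\<^sub>R (axis a 1 + axis b 1) \<in> ?C"
          by (rule add[OF y conicD[OF conic_conic_hull _ t]])
      qed auto
    qed
  qed
  finally show ?thesis .
qed

lemma normal_monoid_ring_edge_ring:
  "normal_monoid_ring (edge_ring (multipartite_edges n V) :: ('v, 'k::field) laurent set) even_lattice forms"
proof
  show "edge_ring (multipartite_edges n V) =
      {f :: ('v, 'k) laurent. Poly_Mapping.keys f \<subseteq> {u \<in> even_lattice. \<forall>w\<in>forms. 0 \<le> w \<bullet> real_vec u}}"
    by (simp add: edge_ring_eq cone_monoid_def)
  show "\<exists>u\<in>even_lattice. w \<bullet> real_vec u = 1" if w: "w \<in> forms" for w
  proof -
    obtain a b where "w \<bullet> (axis a 1 + axis b 1) = 1"
      using ex_edge_form_1[OF w] by metis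
    then show ?thesis
      using edge_in_even_lattice by (metis real_vec_edge)
  qed
qed (simp_all add: zero_even_lattice diff_even_lattice finite_forms lattice_integral
    facet_lattice_point interior_lattice_point exp_cone_edge_ring span_even_lattice)

end

subsection \<open>Classes of conic divisorial ideals\<close>

text \<open>\<open>h\<close> is a complete invariant of the classes, although \<open>g\<close> may
  send several parameters to one object. The value of \<open>h\<close> on a class does not depend on
  the parameter chosen: \<open>g s = g y\<close> gives \<open>P (g s) (g y)\<close> from
  \<open>P (g y) (g y)\<close>, hence \<open>h s = h y\<close>.\<close>

lemma bij_betw_quotient_invariant:
  assumes rel: "\<And>x y. P (g x) (g y) \<longleftrightarrow> h x = h y"
  shows "\<exists>f. bij_betw f (range g // {(M, N). M \<in> range g \<and> N \<in> range g \<and> P M N}) (range h)"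
proof -
  let ?r = "{(M, N). M \<in> range g \<and> N \<in> range g \<and> P M N}"
  define f where "f C = h (SOME x. g x \<in> C)" for C
  have cls: "?r `` {g x} = {g y | y. h y = h x}" for x
    by (force simp: rel)
  have f: "f {g y | y. h y = h x} = h x" for x
  proof -
    define s where "s = (SOME s. g s \<in> {g y | y. h y = h x})"
    have "g s \<in> {g y | y. h y = h x}"
      unfolding s_def by (rule someI[of "\<lambda>s. g s \<in> {g y | y. h y = h x}" x]) blast
    then obtain y where "g s = g y" "h y = h x"
      by blast
    then have "h s = h x"
      using rel[of s y] rel[of y y] by simp
    then show ?thesis
      by (simp only: f_def s_def)
  qed
  have quotient: "range g // ?r = range (\<lambda>x. {g y | y. h y = h x})"
    by (simp only: quotient_def UNION_singleton_eq_range image_image cls)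
  have "inj_on f (range g // ?r)"
    unfolding quotient by (rule inj_onI) (auto simp: f)
  moreover have "f ` (range g // ?r) = range h"
    unfolding quotient by (simp add: image_image f)
  ultimately show ?thesis
    by (auto simp: bij_betw_def)
qed

section \<open>The class of a conic ideal as an integer point\<close>

context complete_multipartite
begin

text \<open>Each \<open>y i\<close> contains half the sum over the vertices and may be a
  half-integer; in \<open>y i + y n\<close> the halves combine.\<close>

definition class_coord :: "(real ^ 'v \<Rightarrow> int) \<Rightarrow> nat \<Rightarrow> int" where
  "class_coord a i = a (part_form i) + a (part_form n) - (\<Sum>v\<in>UNIV. a (axis v 1))
     + (\<Sum>v\<in>V i. a (axis v 1)) + (\<Sum>v\<in>V n. a (axis v 1))"

text \<open>The values of the forms at a lattice vector contribute 0 to every coordinate.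
  Conversely, the differences at the vertices define \<open>u\<close>; the coordinate at
  \<open>n\<close> shows that its sum is even, and the other coordinates then fix the values at the
  part forms.\<close>

lemma class_coord_eq_iff:
  "(\<exists>u\<in>even_lattice. \<forall>w\<in>forms. real_of_int (b w) = a w + w \<bullet> real_vec u) \<longleftrightarrow>
    (\<forall>i\<in>{1..n}. class_coord a i = class_coord b i)"
proof
  assume "\<exists>u\<in>even_lattice. \<forall>w\<in>forms. real_of_int (b w) = a w + w \<bullet> real_vec u"
  then obtain u where u: "\<And>w. w \<in> forms \<Longrightarrow> real_of_int (b w) = a w + w \<bullet> real_vec u"
    by blast
  have axis: "b (axis v 1) = a (axis v 1) + u $ v" for v
    using u[of "axis v 1"] by (simp add: forms_def inner_axis_one real_vec_def flip: of_int_add)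
  have part: "real_of_int (b (part_form i)) =
      a (part_form i) + of_int (\<Sum>v\<in>UNIV. u $ v) / 2 - of_int (\<Sum>v\<in>V i. u $ v)"
    if "i \<in> {1..n}" for i
    using u[of "part_form i"] that by (simp add: forms_def inner_part_form sum_real_vec)
  have n: "n \<in> {1..n}"
    using n_ge by simp
  show "\<forall>i\<in>{1..n}. class_coord a i = class_coord b i"
  proof
    fix i assume i: "i \<in> {1..n}"
    have "real_of_int (class_coord b i) = real_of_int (class_coord a i)"
      unfolding class_coord_def of_int_add of_int_diff part[OF i] part[OF n] axis sum.distrib by simp
    then show "class_coord a i = class_coord b i"
      by simp
  qed
next
  assume eq: "\<forall>i\<in>{1..n}. class_coord a i = class_coord b i"
  define u :: "int ^ 'v" where "u = (\<chi> v. b (axis v 1) - a (axis v 1))"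
  define d where "d i = b (part_form i) - a (part_form i)" for i
  have diff: "d i + d n = (\<Sum>v\<in>UNIV. u $ v) - (\<Sum>v\<in>V i. u $ v) - (\<Sum>v\<in>V n. u $ v)"
    if "i \<in> {1..n}" for i
    using eq that by (auto simp: class_coord_def u_def d_def sum_subtractf algebra_simps)
  have n: "n \<in> {1..n}"
    using n_ge by simp
  have dn: "2 * d n = (\<Sum>v\<in>UNIV. u $ v) - 2 * (\<Sum>v\<in>V n. u $ v)"
    using diff[OF n] by simp
  then have total: "(\<Sum>v\<in>UNIV. u $ v) = 2 * (d n + (\<Sum>v\<in>V n. u $ v))"
    by simp
  then have "u \<in> even_lattice"
    by (simp add: even_lattice_def)
  moreover have "real_of_int (b w) = a w + w \<bullet> real_vec u" if "w \<in> forms" for w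
    using that
  proof (cases rule: forms_cases)
    case (1 v)
    then show ?thesis
      by (simp add: inner_axis_one real_vec_def u_def)
  next
    case (2 i)
    have "2 * d i = (\<Sum>v\<in>UNIV. u $ v) - 2 * (\<Sum>v\<in>V i. u $ v)"
      using diff[OF 2(1)] dn by simp
    then have "real_of_int (2 * d i) = real_of_int ((\<Sum>v\<in>UNIV. u $ v) - 2 * (\<Sum>v\<in>V i. u $ v))"
      by simp
    then show ?thesis
      unfolding 2 inner_part_form sum_real_vec by (simp add: d_def field_simps)
  qed
  ultimately show "\<exists>u\<in>even_lattice. \<forall>w\<in>forms. real_of_int (b w) = a w + w \<bullet> real_vec u"
    by blast
qed

definition conic_point :: "real ^ 'v \<Rightarrow> nat \<Rightarrow> real" where
  "conic_point x = (\<lambda>i\<in>{1..n}. real_of_int (class_coord (\<lambda>w. \<lceil>w \<bullet> x\<rceil>) i))"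

lemma conic_point_eq_iff:
  "conic_point x = conic_point y \<longleftrightarrow>
    (\<forall>i\<in>{1..n}. class_coord (\<lambda>w. \<lceil>w \<bullet> x\<rceil>) i = class_coord (\<lambda>w. \<lceil>w \<bullet> y\<rceil>) i)"
  by (auto simp: conic_point_def restrict_def fun_eq_iff)

text \<open>The coordinate formula is linear and vanishes on the exact values
  \<open>w \<bullet> x\<close>, so only the rounding errors of the ceilings remain, collected in
  \<open>F\<close> and \<open>g\<close>.\<close>

lemma conic_point_in_polytope:
  assumes sizes: "\<And>i. i \<in> {1..n} \<Longrightarrow> card (V i) = r i"
  shows "conic_point x \<in> multipartite_polytope n r \<inter> integer_points n"
proof
  define f where "f v = \<lceil>x $ v\<rceil> - x $ v" for v
  define F where "F i = (\<Sum>v\<in>V i. f v)" for i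
  define g where "g i = \<lceil>part_form i \<bullet> x\<rceil> - part_form i \<bullet> x" for i
  have f: "0 \<le> f v" "f v < 1" for v
    by (simp_all add: f_def) linarith+
  have g: "0 \<le> g i" "g i < 1" for i
    by (simp_all add: g_def) linarith+
  show int: "conic_point x \<in> integer_points n"
    by (auto simp: conic_point_def integer_points_def)
  show "conic_point x \<in> multipartite_polytope n r"
  proof (rule in_polytope_of_decomposition[OF n_ge _ _ _ int])
    show "0 \<le> F i \<and> F i < r i" if "i \<in> {1..n}" for i
    proof
      show "0 \<le> F i"
        using f by (simp add: F_def sum_nonneg)
      have "F i < (\<Sum>v\<in>V i. 1)"
        unfolding F_def using f nonempty[OF that] by (intro sum_strict_mono) auto
      then show "F i < r i"
        by (simp add: sizes[OF that])
    qed
    show "0 \<le> g i \<and> g i < 1" for i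
      using g by simp
    show "conic_point x i = g i + g n + F i + F n - sum F {1..n}" if "i \<in> {1..n}" for i
    proof -
      have "sum F {1..n} = (\<Sum>v\<in>UNIV. f v)"
        by (simp add: F_def sum_parts)
      then show ?thesis
        using that unfolding g_def inner_part_form F_def f_def
        by (simp add: conic_point_def class_coord_def inner_axis_one sum_subtractf inner_part_form)
    qed
  qed
qed

text \<open>The point \<open>x\<close> has ceilings \<open>a\<close> at the vertices and rounding
  errors \<open>f\<close> that spread \<open>F i\<close> evenly over \<open>V i\<close>; the
  \<open>g i\<close> then become the rounding errors at the part forms.\<close>

lemma conic_point_surj:
  assumes n4: "n \<le> 4" and sizes: "\<And>i. i \<in> {1..n} \<Longrightarrow> card (V i) = r i"
    and z: "z \<in> multipartite_polytope n r \<inter> integer_points n"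
  obtains x where "conic_point x = z"
proof -
  have "1 \<le> r i" if "i \<in> {1..n}" for i
    using nonempty[OF that] sizes[OF that] by (auto simp: Suc_le_eq simp flip: sizes)
  moreover have "n = 3 \<or> n = 4"
    using n4 n_ge by linarith
  ultimately obtain F g :: "nat \<Rightarrow> real"
    where F: "\<And>i. i \<in> {1..n} \<Longrightarrow> 0 \<le> F i \<and> F i < r i"
      and g: "\<And>i. i \<in> {1..n} \<Longrightarrow> 0 \<le> g i \<and> g i < 1"
      and zi: "\<And>i. i \<in> {1..n} \<Longrightarrow> z i = g i + g n + F i + F n - sum F {1..n}"
    using polytope_point_decomposition[of n r z] z by (metis IntD1)
  have n: "n \<in> {1..n}"
    using n_ge by simp
  have zZ: "z i \<in> \<int>" if "i \<in> {1..n}" for i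
    using z that by (auto simp: integer_points_def)
  define k where "k i = \<lfloor>z i\<rfloor>" for i
  have k: "z i = of_int (k i)" if "i \<in> {1..n}" for i
    using zZ[OF that] by (auto simp: k_def elim: Ints_cases)
  obtain v0 :: 'v where True
    by blast
  \<comment> \<open>Since the coordinate at \<open>n\<close> is twice an integer minus
    \<open>A\<close>, the sum \<open>A\<close> must have the parity of \<open>k n\<close>. One
    vertex suffices to arrange this, and \<open>m\<close> becomes an integer.\<close>
  define a :: "'v \<Rightarrow> int" where "a v = (if v = v0 then k n mod 2 else 0)" for v
  define A where "A = (\<Sum>v\<in>UNIV. a v)"
  have "A = k n mod 2"
    by (simp add: A_def a_def)
  then obtain m where m: "A - k n = 2 * m"
    by (metis dvd_def mod_eq_dvd_iff mod_mod_trivial)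
  define f where "f v = F (part_of v) / card (V (part_of v))" for v
  have f: "0 \<le> f v \<and> f v < 1" for v
  proof -
    obtain i where i: "i \<in> {1..n}" "v \<in> V i"
      using ex_part by blast
    then show ?thesis
      using F[OF i(1)] part_of_eq[OF i] sizes[OF i(1)] by (simp add: f_def divide_less_eq)
  qed
  define x :: "real ^ 'v" where "x = (\<chi> v. a v - f v)"
  have ceil_axis: "\<lceil>axis v 1 \<bullet> x\<rceil> = a v" for v
    using f[of v] by (simp add: inner_axis_one x_def ceiling_unique)
  have F_sum: "(\<Sum>v\<in>V i. f v) = F i" if i: "i \<in> {1..n}" for i
  proof -
    have "(\<Sum>v\<in>V i. f v) = (\<Sum>v\<in>V i. F i / card (V i))"
      using part_of_eq[OF i] by (intro sum.cong) (auto simp: f_def)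
    then show ?thesis
      using nonempty[OF i] by simp
  qed
  have F_total: "(\<Sum>v\<in>UNIV. f v) = sum F {1..n}"
    by (simp add: sum_parts F_sum)
  \<comment> \<open>The right-hand side is \<open>y i + A / 2\<close> minus the sum of
    \<open>a\<close> over \<open>V i\<close>, where \<open>y i = z i - z n / 2\<close>; it exceeds
    the form's value at \<open>x\<close> by exactly \<open>g i\<close>.\<close>
  have ceil_part: "\<lceil>part_form i \<bullet> x\<rceil> = k i + m - (\<Sum>v\<in>V i. a v)" if i: "i \<in> {1..n}" for i
  proof -
    have "part_form i \<bullet> x = A / 2 - sum F {1..n} / 2 - (\<Sum>v\<in>V i. a v) + F i"
      unfolding inner_part_form by (simp add: x_def sum_subtractf F_total F_sum[OF i] A_def diff_divide_distrib)
    moreover have "real_of_int m = (real_of_int A - z n) / 2"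
      using arg_cong[OF m, of real_of_int] k[OF n] by simp
    ultimately have "real_of_int (k i + m - (\<Sum>v\<in>V i. a v)) = part_form i \<bullet> x + g i"
      using zi[OF i] zi[OF n] k[OF i] by (simp add: field_simps)
    then show ?thesis
      using g[OF i] by (intro ceiling_unique) auto
  qed
  have "conic_point x = z"
  proof
    fix i
    show "conic_point x i = z i"
    proof (cases "i \<in> {1..n}")
      case True
      have "class_coord (\<lambda>w. \<lceil>w \<bullet> x\<rceil>) i = k i"
        using m unfolding class_coord_def ceil_part[OF True] ceil_part[OF n] ceil_axis A_def by simp
      then show ?thesis
        using True k[OF True] by (simp add: conic_point_def)
    next
      case False
      then have "conic_point x i = undefined"
        by (simp only: conic_point_def restrict_apply if_False)
      moreover have "z i = undefined"
        using z False by (auto simp: integer_points_def PiE_def extensional_def)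
      ultimately show ?thesis
        by simp
    qed
  qed
  then show ?thesis
    by (rule that)
qed

lemma conic_classes_bij:
  assumes "n \<le> 4" "\<And>i. i \<in> {1..n} \<Longrightarrow> card (V i) = r i"
  shows "\<exists>f. bij_betw f
    (conic_classes (edge_ring (multipartite_edges n V) :: ('v, 'k::field) laurent set))
    (multipartite_polytope n r \<inter> integer_points n)"
proof -
  let ?R = "edge_ring (multipartite_edges n V) :: ('v, 'k) laurent set"
  interpret normal_monoid_ring ?R even_lattice forms
    by (rule normal_monoid_ring_edge_ring)
  let ?g = "\<lambda>x. divisorial_ideal ?R (\<lambda>w. \<lceil>w \<bullet> x\<rceil>)"
  have "module_iso ?R (?g x) (?g y) \<longleftrightarrow> conic_point x = conic_point y" for x y
    unfolding module_iso_iff class_coord_eq_iff conic_point_eq_iff ..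
  then have "\<exists>f. bij_betw f (range ?g // {(M, N). M \<in> range ?g \<and> N \<in> range ?g \<and> module_iso ?R M N})
      (range conic_point)"
    by (rule bij_betw_quotient_invariant)
  moreover have "range conic_point = multipartite_polytope n r \<inter> integer_points n"
  proof
    show "range conic_point \<subseteq> multipartite_polytope n r \<inter> integer_points n"
      using conic_point_in_polytope[OF assms(2)] by blast
    show "multipartite_polytope n r \<inter> integer_points n \<subseteq> range conic_point"
      using conic_point_surj[OF assms] by (metis rangeI subsetI)
  qed
  ultimately show ?thesis
    by (simp only: conic_classes_def conic_divisorial_ideals_eq)
qed

end

theorem theorem1p5:
  fixes n :: nat and r :: "nat \<Rightarrow> nat" and V :: "nat \<Rightarrow> 'v::finite set"
  assumes disjoint: "disjoint_family_on V {1..n}"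
    and vertices: "(\<Union>i\<in>{1..n}. V i) = UNIV"
    and sizes: "\<And>i. i \<in> {1..n} \<Longrightarrow> card (V i) = r i"
    and pos: "1 \<le> r 1"
    and sorted: "mono_on {1..n} r"
    and n_le: "n \<le> 4"
    and n_ge: "3 \<le> n"
    and tripartite: "n = 3 \<Longrightarrow> 2 \<le> r 1"
  shows "\<exists>f. bij_betw f
    (conic_classes
      (edge_ring (multipartite_edges n V) :: ('v, 'k::{alg_closed_field, field_char_0}) laurent set))
    (multipartite_polytope n r \<inter> integer_points n)"
proof -
  have r: "r 1 \<le> r i" if "i \<in> {1..n}" for i
    using sorted that n_ge by (intro mono_onD[OF sorted]) auto
  interpret complete_multipartite n V
  proof
    show "V i \<noteq> {}" if "i \<in> {1..n}" for i
      using sizes[OF that] r[OF that] pos by auto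
    show "2 \<le> card (V i)" if "n = 3" "i \<in> {1..n}" for i
      using sizes[OF that(2)] r[OF that(2)] tripartite[OF that(1)] by simp
  qed (fact disjoint vertices n_ge)+
  show ?thesis
    by (rule conic_classes_bij[OF n_le sizes])
qed

end
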